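(* (a) Let $\alpha\in\mathbb{R}\setminus\mathbb{Q}$, $\beta\in\mathbb{R}\setminus\{0\}$ and $r,R>1$. Then there exists a proper holomorphic mapping $D_{\alpha,r}\to D_{\beta,R}$ if and only if $$\frac{\log R}{\log r}\in\mathbb{Z}+\beta\mathbb{Z}\quad\text{and}\quad \alpha\frac{\log R}{\log r}\in\mathbb{Z}+\beta\mathbb{Z}.$$ (b) Let $\alpha,\beta\in\mathbb{R}\setminus\mathbb{Q}$ and $r,R>1$ be such that $\frac{\log R}{\log r}=k_1+l_1\beta$ and $\alpha\frac{\log R}{\log r}=k_2+l_2\beta$ for some integers $k_1,k_2,l_1,l_2$. Then any proper holomorphic mapping $f:D_{\alpha,r}\to D_{\beta,R}$ is given by one of the following forms: $$f(z)=(az_1^{k_1}z_2^{k_2},\,bz_1^{l_1}z_2^{l_2}),\quad z=(z_1,z_2)\in D_{\alpha,r},$$ or $$f(z)=(az_1^{-k_1}z_2^{-k_2},\,bz_1^{-l_1}z_2^{-l_2}),\quad z=(z_1,z_2)\in D_{\alpha,r},$$ where $a,b\in\mathbb{C}$ satisfy $|a||b|^{\beta}=1$. Moreover, any mapping given by one of these formulas (with $|a||b|^\beta=1$) is a proper holomorphic mapping $D_{\alpha,r}\to D_{\beta,R}$.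
   Context: For $\gamma\in\mathbb{R}\setminus\{0\}$ and $\rho>1$, $D_{\gamma,\rho}:=\{(z_1,z_2)\in\mathbb{C}^2:\ 1/\rho<|z_1||z_2|^{\gamma}<\rho\}$; only points $z$ for which the expression $|z_1||z_2|^\gamma$ makes sense are considered (so $z_2\neq0$ if $\gamma<0$). $\mathbb{Z}+\beta\mathbb{Z}=\{k+l\beta:\ k,l\in\mathbb{Z}\}$. A mapping is proper if preimages of compact sets are compact. *)

theory Defs
  imports "HOL-Analysis.Analysis"
begin

text \<open>
  The condition \<open>\<gamma> < 0 \<longrightarrow> z2 \<noteq> 0\<close> makes explicit that only points where
  \<open>\<bar>z1\<bar>\<bar>z2\<bar>\<^sup>\<gamma>\<close> is meaningful belong to the domain; the totalised \<open>0 powr \<gamma> = 0\<close>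
  excludes them anyway.
\<close>
definition D :: "real \<Rightarrow> real \<Rightarrow> (complex \<times> complex) set" where
  "D \<gamma> \<rho> = {(z1, z2). (\<gamma> < 0 \<longrightarrow> z2 \<noteq> 0) \<and>
     1 / \<rho> < norm z1 * norm z2 powr \<gamma> \<and> norm z1 * norm z2 powr \<gamma> < \<rho>}"

definition int_span :: "real \<Rightarrow> real set" where
  "int_span \<beta> = {of_int k + of_int l * \<beta> | k l :: int. True}"

definition cscale :: "complex \<Rightarrow> complex \<times> complex \<Rightarrow> complex \<times> complex" where
  "cscale c v = (c * fst v, c * snd v)"

text \<open>
  Holomorphy in two variables on an open set: complex Frechet differentiability at every point,
  i.e. the real derivative exists and is complex-linear (additivity is part of
  \<open>has_derivative\<close>).
\<close>
definition holomorphic_map_on ::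
    "(complex \<times> complex \<Rightarrow> complex \<times> complex) \<Rightarrow> (complex \<times> complex) set \<Rightarrow> bool" where
  "holomorphic_map_on f U \<longleftrightarrow>
     (\<forall>z\<in>U. \<exists>f'. (f has_derivative f') (at z) \<and> (\<forall>c v. f' (cscale c v) = cscale c (f' v)))"

text \<open>
  Compactness is intrinsic, so a compact subset of the subspace \<open>V\<close> is a compact set
  contained in \<open>V\<close>. Values of \<open>f\<close> outside \<open>U\<close> are irrelevant when \<open>U\<close> is open.
\<close>
definition proper_holomorphic_map ::
    "(complex \<times> complex) set \<Rightarrow> (complex \<times> complex) set \<Rightarrow>
     (complex \<times> complex \<Rightarrow> complex \<times> complex) \<Rightarrow> bool" where
  "proper_holomorphic_map U V f \<longleftrightarrow>
     holomorphic_map_on f U \<and> f ` U \<subseteq> V \<and>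
     (\<forall>K. K \<subseteq> V \<and> compact K \<longrightarrow> compact {z \<in> U. f z \<in> K})"

end

theory Submission
  imports Defs "HOL-Complex_Analysis.Complex_Analysis"
begin

text \<open>
  The map \<open>(t, w) \<mapsto> (exp (t - \<alpha> w), exp w)\<close> covers \<open>D \<alpha> r\<close> by the product of the strip
  \<open>\<bar>Re t\<bar> < ln r\<close> with \<open>\<complex>\<close>; fixing \<open>t\<close> gives an entire curve, a leaf. Along each leaf the
  components \<open>f\<^sub>1, f\<^sub>2\<close> of a proper map \<open>f\<close> have entire logarithms \<open>g\<^sub>1, g\<^sub>2\<close>. The real part of
  \<open>g\<^sub>1 + \<beta> g\<^sub>2\<close> is bounded because \<open>f\<close> takes values in \<open>D \<beta> R\<close>, so this function is constant
  by Liouville's theorem. So \<open>f\<close> maps the leaf into a single level set of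
  \<open>ln \<bar>z\<^sub>1\<bar> + \<beta> ln \<bar>z\<^sub>2\<bar>\<close>, in which the points with \<open>\<bar>ln \<bar>z\<^sub>2\<bar>\<bar> \<le> 1\<close> form a compact set.
  Properness now says that \<open>\<bar>Re (g\<^sub>2 w)\<bar> \<ge> 1\<close> as soon as \<open>\<bar>Re w\<bar>\<close> is large. Thus \<open>g\<^sub>2\<close> maps a right
  half-plane and a left half-plane into half-planes, while on the vertical strip between them its
  real part is bounded by compactness; the Schwarz lemma turns this into a bound for the derivative
  of \<open>g\<^sub>2\<close> on the whole plane, and \<open>g\<^sub>2\<close> is affine
  (\<open>entire_affine_if_Re_large_off_strip\<close>, \<open>proper_map_exponential_on_leaves\<close>).

  The dependence on \<open>t\<close> is controlled by the deck transformations
  \<open>(t, w) \<mapsto> (t + 2 \<pi> i, w)\<close> and \<open>(t, w) \<mapsto> (t + 2 \<pi> i \<alpha>, w + 2 \<pi> i)\<close>. A holomorphic function on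
  the strip with both periods \<open>2 \<pi> i\<close> and \<open>2 \<pi> i \<alpha>\<close> is constant, because \<open>\<alpha>\<close> is irrational
  (\<open>two_imaginary_periods_imp_constant\<close>). Applied to suitable quotients, this makes both components
  of \<open>f\<close> monomials (\<open>exponential_on_leaves_imp_monomial\<close>, \<open>proper_map_is_monomial\<close>).

  For a monomial map, \<open>ln \<bar>f\<^sub>1\<bar> + \<beta> ln \<bar>f\<^sub>2\<bar>\<close> is an affine function of \<open>ln \<bar>z\<^sub>1\<bar>\<close> and \<open>ln \<bar>z\<^sub>2\<bar>\<close>. It is
  bounded on \<open>D \<alpha> r\<close>, hence of the form \<open>d + c (ln \<bar>z\<^sub>1\<bar> + \<alpha> ln \<bar>z\<^sub>2\<bar>)\<close>, and properness sends the
  ends of \<open>(-ln r, ln r)\<close> to those of \<open>(-ln R, ln R)\<close>, so \<open>d = 0\<close> and \<open>\<bar>c\<bar> = ln R / ln r\<close>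
  (\<open>proper_monomial_map_exponents\<close>). These are the arithmetic conditions of the theorem; if
  \<open>\<beta>\<close> is irrational, they determine the exponents up to a common sign. Conversely, the conditions
  force the exponent matrix to be invertible, which makes the monomial map proper
  (\<open>monomial_map_proper\<close>).
\<close>

section \<open>The domains in logarithmic coordinates\<close>

lemma mem_D_iff:
  assumes "\<rho> > 1"
  shows "(z1, z2) \<in> D \<gamma> \<rho> \<longleftrightarrow>
    z1 \<noteq> 0 \<and> z2 \<noteq> 0 \<and> \<bar>ln (norm z1) + \<gamma> * ln (norm z2)\<bar> < ln \<rho>"
proof (cases "z1 = 0 \<or> z2 = 0")
  case True
  then show ?thesis using assms by (auto simp: D_def divide_less_0_iff)
next
  case False
  have eq: "norm z1 * norm z2 powr \<gamma> = exp (ln (norm z1) + \<gamma> * ln (norm z2))"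
    using False by (simp add: powr_def exp_add)
  have "1 / \<rho> < exp s \<longleftrightarrow> - ln \<rho> < s" "exp s < \<rho> \<longleftrightarrow> s < ln \<rho>" for s
    using assms exp_less_cancel_iff[of "- ln \<rho>" s] exp_less_cancel_iff[of s "ln \<rho>"]
    by (simp_all add: exp_minus inverse_eq_divide)
  then show ?thesis
    unfolding D_def using False by (auto simp: eq)
qed

lemma continuous_on_log_level:
  assumes "S \<subseteq> {z. fst z \<noteq> 0 \<and> snd z \<noteq> 0}"
  shows "continuous_on S (\<lambda>z :: complex \<times> complex. ln (norm (fst z)) + \<gamma> * ln (norm (snd z)))"
  using assms by (intro continuous_intros) auto

lemma open_D:
  assumes "\<rho> > 1"
  shows "open (D \<gamma> \<rho>)"
proof -
  let ?T = "{z :: complex \<times> complex. fst z \<noteq> 0 \<and> snd z \<noteq> 0}"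
  let ?g = "\<lambda>z :: complex \<times> complex. ln (norm (fst z)) + \<gamma> * ln (norm (snd z))"
  have T: "open ?T"
    by (intro open_Collect_conj open_Collect_neq continuous_intros)
  have "D \<gamma> \<rho> = ?T \<inter> ?g -` {- ln \<rho> <..< ln \<rho>}"
    using mem_D_iff[OF assms] by (auto simp: set_eq_iff)
  moreover have "open (?T \<inter> ?g -` {- ln \<rho> <..< ln \<rho>})"
    by (intro continuous_open_preimage continuous_on_log_level T) auto
  ultimately show ?thesis by simp
qed

text \<open>
  These Reinhardt sets exhaust the pairs of nonzero numbers by compact sets, so a subset of
  \<open>(\<complex> - {0})\<^sup>2\<close> lies in a compact set as soon as both \<open>\<bar>ln \<bar>z\<^sub>1\<bar>\<bar>\<close> and \<open>\<bar>ln \<bar>z\<^sub>2\<bar>\<bar>\<close> are bounded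
  on it.
\<close>

definition torus_box :: "real \<Rightarrow> (complex \<times> complex) set" where
  "torus_box M = {z. fst z \<noteq> 0 \<and> snd z \<noteq> 0 \<and>
     \<bar>ln (norm (fst z))\<bar> \<le> M \<and> \<bar>ln (norm (snd z))\<bar> \<le> M}"

lemma compact_torus_box: "compact (torus_box M)"
proof -
  have iff: "x \<noteq> 0 \<and> \<bar>ln (norm x)\<bar> \<le> M \<longleftrightarrow> exp (- M) \<le> norm x \<and> norm x \<le> exp M" for x :: complex
  proof (cases "x = 0")
    case False
    then have "norm x = exp (ln (norm x))" by simp
    then have "exp (- M) \<le> norm x \<longleftrightarrow> - M \<le> ln (norm x)" "norm x \<le> exp M \<longleftrightarrow> ln (norm x) \<le> M"
      by (metis exp_le_cancel_iff)+
    then show ?thesis using False by auto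
  qed simp
  define A where "A = {x :: complex. exp (- M) \<le> norm x \<and> norm x \<le> exp M}"
  have "closed A"
    unfolding A_def by (intro closed_Collect_conj closed_Collect_le continuous_intros)
  moreover have "bounded A" unfolding A_def bounded_iff by blast
  ultimately have "compact A" by (simp add: compact_eq_bounded_closed)
  moreover have "torus_box M = A \<times> A"
    unfolding torus_box_def A_def using iff by (auto simp: set_eq_iff)
  ultimately show ?thesis by (simp add: compact_Times)
qed

text \<open>
  A level set of \<open>ln \<bar>z\<^sub>1\<bar> + \<gamma> ln \<bar>z\<^sub>2\<bar>\<close> with value in \<open>(-ln \<rho>, ln \<rho>)\<close> avoids the boundary of
  \<open>D \<gamma> \<rho>\<close>, so cutting it with a box gives the compact subsets of \<open>D \<gamma> \<rho>\<close> to which properness and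
  continuity are applied.
\<close>

lemma compact_torus_box_level:
  "compact {z \<in> torus_box M. ln (norm (fst z)) + \<gamma> * ln (norm (snd z)) = c}"
proof -
  have "closed {z \<in> torus_box M. ln (norm (fst z)) + \<gamma> * ln (norm (snd z)) = c}"
    using compact_torus_box
    by (intro continuous_closed_preimage_constant continuous_on_log_level compact_imp_closed)
      (auto simp: torus_box_def)
  then have "compact (torus_box M \<inter> {z \<in> torus_box M. ln (norm (fst z)) + \<gamma> * ln (norm (snd z)) = c})"
    using compact_torus_box by (rule compact_Int_closed[rotated])
  then show ?thesis by (simp add: Int_absorb1 Collect_mono_iff subset_iff)
qed

section \<open>Entire functions whose real part is large off a vertical strip\<close>

lemma norm_Cayley_less_1:
  assumes "Re x > 0" "Re y > 0"
  shows "norm ((x - y) / (x + cnj y)) < 1"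
proof -
  have "(Re x - Re y)^2 < (Re x + Re y)^2"
    using mult_pos_pos[OF assms] by (simp add: power2_eq_square algebra_simps)
  then have "norm (x - y) < norm (x + cnj y)"
    by (simp add: cmod_def)
  then show ?thesis
    by (simp add: norm_divide divide_simps)
qed

text \<open>
  The Schwarz lemma in half-plane form: the Cayley transform \<open>x \<mapsto> (x - F a) / (x + cnj (F a))\<close> maps
  the right half-plane to the unit disc and \<open>F a\<close> to the origin. The second inequality is Harnack's
  inequality for the positive harmonic function \<open>Re F\<close>.
\<close>

lemma positive_real_part_Schwarz:
  assumes hol: "F holomorphic_on ball a \<rho>" and "\<rho> > 0"
    and pos: "\<And>z. z \<in> ball a \<rho> \<Longrightarrow> Re (F z) > 0"
  shows "norm (deriv F a) \<le> 2 * Re (F a) / \<rho>"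
    and "z \<in> ball a \<rho> \<Longrightarrow> \<rho> * \<bar>Re (F z) - Re (F a)\<bar> \<le> norm (z - a) * (Re (F z) + Re (F a))"
proof -
  define A where "A = F a"
  define G where "G = (\<lambda>w. (F (a + of_real \<rho> * w) - A) / (F (a + of_real \<rho> * w) + cnj A))"
  have A: "Re A > 0" unfolding A_def using pos \<open>\<rho> > 0\<close> by simp
  have in_ball: "a + of_real \<rho> * w \<in> ball a \<rho>" if "norm w < 1" for w
    using that \<open>\<rho> > 0\<close> by (simp add: dist_norm norm_mult)
  have nz: "F (a + of_real \<rho> * w) + cnj A \<noteq> 0" if "norm w < 1" for w
  proof -
    have "Re (F (a + of_real \<rho> * w) + cnj A) > 0"
      using pos[OF in_ball[OF that]] A by simp
    then show ?thesis by (metis less_irrefl zero_complex.simps(1))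
  qed
  have "(\<lambda>w. F (a + of_real \<rho> * w)) holomorphic_on ball 0 1"
    using in_ball
    by (intro holomorphic_on_compose_gen[OF _ hol, unfolded o_def] holomorphic_intros) auto
  then have holG: "G holomorphic_on ball 0 1"
    unfolding G_def using nz by (intro holomorphic_intros) auto
  have G0: "G 0 = 0" by (simp add: G_def A_def)
  have no: "norm (G w) < 1" if "norm w < 1" for w
    unfolding G_def using norm_Cayley_less_1[OF pos[OF in_ball[OF that]] A] .
  note S = Schwarz_Lemma[OF holG G0 no]
  have dF: "(F has_field_derivative deriv F a) (at (a + of_real \<rho> * 0))"
    using holomorphic_derivI[OF hol open_ball, of a] \<open>\<rho> > 0\<close> by simp
  have dF': "((\<lambda>w. F (a + of_real \<rho> * w)) has_field_derivative deriv F a * of_real \<rho>) (at 0)"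
    by (rule DERIV_chain2[where f=F and g="\<lambda>w. a + of_real \<rho> * w", OF dF]) (auto intro!: derivative_eq_intros)
  have "(G has_field_derivative (deriv F a * of_real \<rho>) / (A + cnj A)) (at 0)"
    unfolding G_def using nz[of 0]
    by (auto intro!: derivative_eq_intros dF' simp: A_def)
  then have "norm ((deriv F a * of_real \<rho>) / (A + cnj A)) \<le> 1"
    using S(2)[of 0] DERIV_imp_deriv by fastforce
  moreover have "norm (A + cnj A) = 2 * Re A"
    using A by (simp add: complex_add_cnj)
  ultimately show "norm (deriv F a) \<le> 2 * Re (F a) / \<rho>"
    using A \<open>\<rho> > 0\<close> by (simp add: norm_divide norm_mult A_def field_simps)
  assume z: "z \<in> ball a \<rho>"
  define w where "w = (z - a) / of_real \<rho>"
  have w: "a + of_real \<rho> * w = z" "norm w < 1" "norm w = norm (z - a) / \<rho>"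
    using z \<open>\<rho> > 0\<close> by (auto simp: w_def dist_norm norm_divide norm_minus_commute)
  define \<theta> where "\<theta> = norm w"
  have "norm (G w) \<le> \<theta>"
    using S(1)[of w] w unfolding \<theta>_def by auto
  then have "norm (F z - A) \<le> \<theta> * norm (F z + cnj A)"
    using nz[of w] w by (simp add: G_def norm_divide field_simps)
  then have "norm (F z - A) ^ 2 \<le> \<theta>^2 * norm (F z + cnj A) ^ 2"
    by (metis norm_ge_zero power_mono power_mult_distrib)
  then have le: "(Re (F z) - Re A)^2 + (Im (F z) - Im A)^2
      \<le> \<theta>^2 * ((Re (F z) + Re A)^2 + (Im (F z) - Im A)^2)"
    by (simp add: cmod_power2)
  have "\<theta>^2 \<le> 1" using w(2) unfolding \<theta>_def by (intro power_le_one) auto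
  then have "\<theta>^2 * (Im (F z) - Im A)^2 \<le> 1 * (Im (F z) - Im A)^2"
    by (intro mult_right_mono) auto
  with le have "(Re (F z) - Re A)^2 \<le> \<theta>^2 * (Re (F z) + Re A)^2"
    unfolding distrib_left by linarith
  then have "\<bar>Re (F z) - Re A\<bar> ^ 2 \<le> (\<theta> * (Re (F z) + Re A))^2"
    by (simp add: power_mult_distrib)
  then have "\<bar>Re (F z) - Re A\<bar> \<le> \<theta> * (Re (F z) + Re A)"
  proof (rule power2_le_imp_le)
    show "0 \<le> \<theta> * (Re (F z) + Re A)"
      using pos[OF z] A unfolding \<theta>_def by (intro mult_nonneg_nonneg) auto
  qed
  then show "\<rho> * \<bar>Re (F z) - Re (F a)\<bar> \<le> norm (z - a) * (Re (F z) + Re (F a))"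
    using \<open>\<rho> > 0\<close> w(3) by (simp add: \<theta>_def A_def field_simps)
qed

text \<open>
  The disc about \<open>z\<close> of radius \<open>\<rho> = Re z - N\<close> fits into the half-plane and contains the point \<open>p\<close> at
  the height of \<open>z\<close> on the line \<open>Re = N + 1\<close>. Harnack's inequality from \<open>p\<close> to \<open>z\<close> lets
  \<open>Re F\<close> grow at most by the factor \<open>2 \<rho>\<close>, and the Schwarz estimate \<open>2 Re (F z) / \<rho>\<close> of the
  derivative divides this factor out again.
\<close>

lemma half_plane_deriv_bounded:
  assumes hol: "F holomorphic_on {z. Re z > N}"
    and pos: "\<And>z. Re z > N \<Longrightarrow> Re (F z) > 0"
    and bd: "\<And>z. Re z = N + 1 \<Longrightarrow> Re (F z) \<le> C"
    and z: "Re z \<ge> N + 1"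
  shows "norm (deriv F z) \<le> 4 * C"
proof -
  define \<rho> where "\<rho> = Re z - N"
  define p where "p = Complex (N + 1) (Im z)"
  have \<rho>: "\<rho> \<ge> 1" using z by (simp add: \<rho>_def)
  have sub: "Re w > N" if "w \<in> ball z \<rho>" for w
    using that abs_Re_le_cmod[of "z - w"] by (auto simp: \<rho>_def dist_norm)
  have hol': "F holomorphic_on ball z \<rho>"
    by (rule holomorphic_on_subset[OF hol]) (use sub in auto)
  have pz: "p - z = of_real (1 - \<rho>)"
    by (simp add: p_def \<rho>_def complex_eq_iff)
  then have npz: "norm (p - z) = \<rho> - 1"
    using \<rho> by (metis abs_minus_commute abs_of_nonneg diff_ge_0_iff_ge norm_of_real)
  then have p: "p \<in> ball z \<rho>" by (simp add: dist_norm norm_minus_commute)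
  have "\<rho> > 0" using \<rho> by simp
  note S = positive_real_part_Schwarz[OF hol' \<open>\<rho> > 0\<close> pos[OF sub]]
  have pp: "Re (F p) > 0" "Re (F p) \<le> C"
    using pos[OF sub[OF p]] bd[of p] by (auto simp: p_def)
  have zp: "Re (F z) > 0" using pos[of z] z by simp
  have "\<rho> * (Re (F z) - Re (F p)) \<le> \<rho> * \<bar>Re (F p) - Re (F z)\<bar>"
    using \<rho> by (intro mult_left_mono) auto
  also have "\<dots> \<le> (\<rho> - 1) * (Re (F p) + Re (F z))"
    using S(2)[OF _ p] npz by simp
  finally have "Re (F z) \<le> 2 * \<rho> * Re (F p) - Re (F p)"
    by (simp add: algebra_simps)
  then have "Re (F z) \<le> 2 * \<rho> * C"
    using pp \<rho> mult_left_mono[of "Re (F p)" C "2 * \<rho>"] by linarith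
  then have "2 * Re (F z) / \<rho> \<le> 4 * C"
    using \<rho> by (simp add: field_simps)
  then show ?thesis using S(1) by linarith
qed

lemma connected_avoids_interval:
  fixes g :: "complex \<Rightarrow> real"
  assumes "connected S" "continuous_on S g" "\<And>z. z \<in> S \<Longrightarrow> \<bar>g z\<bar> \<ge> 1"
  shows "(\<forall>z\<in>S. g z > 0) \<or> (\<forall>z\<in>S. g z < 0)"
proof (rule ccontr)
  assume "\<not> ?thesis"
  then obtain x y where xy: "x \<in> S" "y \<in> S" "\<not> g x > 0" "\<not> g y < 0"
    by blast
  have "connected (g ` S)" using assms connected_continuous_image by blast
  then have "0 \<in> g ` S"
    using xy connectedD_interval[of "g ` S" "g x" "g y" 0] by (auto simp: not_less)
  then show False using assms(3) by force
qed

lemma half_plane_deriv_bounded_if_abs_Re_ge_1: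
  assumes hol: "F holomorphic_on {z. Re z > N}"
    and far: "\<And>z. Re z > N \<Longrightarrow> \<bar>Re (F z)\<bar> \<ge> 1"
    and bd: "\<And>z. Re z = N + 1 \<Longrightarrow> \<bar>Re (F z)\<bar> \<le> C"
    and z: "Re z \<ge> N + 1"
  shows "norm (deriv F z) \<le> 4 * C"
proof -
  have op: "open {z. Re z > N}" by (rule open_halfspace_Re_gt)
  have "continuous_on {z. Re z > N} (\<lambda>z. Re (F z))"
    using hol by (intro continuous_intros holomorphic_on_imp_continuous_on)
  then consider "\<forall>z\<in>{z. Re z > N}. Re (F z) > 0" | "\<forall>z\<in>{z. Re z > N}. Re (F z) < 0"
    using connected_avoids_interval[of "{z. Re z > N}" "\<lambda>z. Re (F z)"] far
      convex_connected[OF convex_halfspace_Re_gt] by blast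
  then show ?thesis
  proof cases
    case 1
    show ?thesis
      by (rule half_plane_deriv_bounded[OF hol _ _ z]) (use 1 bd in force)+
  next
    case 2
    have "norm (deriv (\<lambda>z. - F z) z) \<le> 4 * C"
      by (rule half_plane_deriv_bounded[OF _ _ _ z])
        (use 2 bd in \<open>force intro!: holomorphic_intros hol\<close>)+
    moreover have "F field_differentiable at z"
      using hol op z by (intro holomorphic_on_imp_differentiable_at) auto
    ultimately show ?thesis by simp
  qed
qed

text \<open>
  On each of the two half-planes the real part has a constant sign, so the derivative is bounded
  there by the size of the real part on a vertical line. On the remaining strip, adding a constant makes the real part
  positive on unit discs, which bounds the derivative too. An entire function with bounded
  derivative is affine.
\<close>

lemma entire_affine_if_Re_large_off_strip:
  assumes hol: "\<mu> holomorphic_on UNIV" and "N \<ge> 0"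
    and far: "\<And>z. \<bar>Re z\<bar> > N \<Longrightarrow> \<bar>Re (\<mu> z)\<bar> \<ge> 1"
    and bd: "\<And>z. \<bar>Re z\<bar> \<le> N + 2 \<Longrightarrow> \<bar>Re (\<mu> z)\<bar> \<le> C"
  obtains p where "\<And>z. \<mu> z = \<mu> 0 + p * z"
proof -
  have "C \<ge> 0" using bd[of 0] \<open>N \<ge> 0\<close> by simp
  have D: "norm (deriv \<mu> z) \<le> 4 * C + 2" for z
  proof (cases "\<bar>Re z\<bar> \<le> N + 1")
    case True
    have inb: "\<bar>Re (\<mu> w)\<bar> \<le> C" if "w \<in> ball z 1" for w
      using that abs_Re_le_cmod[of "z - w"] True by (intro bd) (auto simp: dist_norm)
    \<comment> \<open>The shift by \<open>C + 1\<close> makes the real part positive on the unit disc about \<open>z\<close>.\<close>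
    have "norm (deriv (\<lambda>w. \<mu> w + of_real (C + 1)) z) \<le> 2 * Re (\<mu> z + of_real (C + 1)) / 1"
      by (rule positive_real_part_Schwarz)
        (use inb in \<open>force intro!: holomorphic_intros holomorphic_on_subset[OF hol]\<close>)+
    moreover have "\<mu> field_differentiable at z"
      using hol by (auto simp: holomorphic_on_def)
    ultimately have "norm (deriv \<mu> z) \<le> 2 * (Re (\<mu> z) + (C + 1))" by simp
    then show ?thesis using inb[of z] by simp
  next
    case False
    then consider "Re z \<ge> N + 1" | "Re (- z) \<ge> N + 1" by force
    then show ?thesis
    proof cases
      case 1
      have "norm (deriv \<mu> z) \<le> 4 * C"
        by (rule half_plane_deriv_bounded_if_abs_Re_ge_1[OF holomorphic_on_subset[OF hol] _ _ 1])
          (use far bd \<open>N \<ge> 0\<close> in auto)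
      then show ?thesis by simp
    next
      case 2
      have "norm (deriv (\<lambda>w. \<mu> (- w)) (- z)) \<le> 4 * C"
        by (rule half_plane_deriv_bounded_if_abs_Re_ge_1[OF _ _ _ 2])
          (use far bd \<open>N \<ge> 0\<close> in
            \<open>auto intro!: holomorphic_on_compose_gen[OF _ hol, unfolded o_def] holomorphic_intros\<close>)
      moreover have "((\<lambda>w. \<mu> (- w)) has_field_derivative deriv \<mu> z * (- 1)) (at (- z))"
        by (rule DERIV_chain2[of \<mu>])
          (use holomorphic_derivI[OF hol open_UNIV, of z] in \<open>auto intro!: derivative_eq_intros\<close>)
      ultimately show ?thesis by (simp add: DERIV_imp_deriv)
    qed
  qed
  have "deriv \<mu> holomorphic_on UNIV" using hol by (intro holomorphic_deriv) auto
  then have "deriv \<mu> constant_on UNIV"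
    by (rule Liouville_theorem) (use D in \<open>auto simp: bounded_iff\<close>)
  then obtain p where p: "\<And>z. deriv \<mu> z = p" by (auto simp: constant_on_def)
  have "((\<lambda>z. \<mu> z - p * z) has_field_derivative 0) (at z)" for z
    using holomorphic_derivI[OF hol open_UNIV, of z] p by (auto intro!: derivative_eq_intros)
  then have "\<mu> z - p * z = \<mu> 0 - p * 0" for z
    using has_field_derivative_zero_constant[of UNIV "\<lambda>z. \<mu> z - p * z"] by (metis UNIV_I convex_UNIV)
  then have "\<mu> z = \<mu> 0 + p * z" for z by (metis add.commute diff_eq_eq diff_zero mult_zero_right)
  then show ?thesis using that by blast
qed

text \<open>
  Liouville's theorem, applied to \<open>exp \<circ> h\<close>.
\<close>

lemma entire_bounded_Re_imp_constant:
  assumes hol: "h holomorphic_on UNIV" and bd: "\<And>z. Re (h z) \<le> B"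
  shows "h z = h 0"
proof -
  have "(\<lambda>z. exp (h z)) constant_on UNIV"
  proof (rule Liouville_theorem)
    show "(\<lambda>z. exp (h z)) holomorphic_on UNIV" using hol by (intro holomorphic_intros)
    show "bounded (range (\<lambda>z. exp (h z)))" using bd by (auto simp: bounded_iff)
  qed
  then obtain c where c: "\<And>z. exp (h z) = c" by (auto simp: constant_on_def)
  have "deriv h z = 0" for z
  proof -
    have "((\<lambda>z. exp (h z)) has_field_derivative exp (h z) * deriv h z) (at z)"
      using holomorphic_derivI[OF hol open_UNIV, of z] by (auto intro!: derivative_eq_intros)
    moreover have "((\<lambda>z. exp (h z)) has_field_derivative 0) (at z)"
      unfolding c by simp
    ultimately show ?thesis using DERIV_unique by fastforce
  qed
  then have "(h has_field_derivative 0) (at z)" for z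
    using holomorphic_derivI[OF hol open_UNIV, of z] by simp
  then have "\<exists>c. \<forall>z\<in>UNIV. h z = c"
    by (intro has_field_derivative_zero_constant) auto
  then show ?thesis by auto
qed

section \<open>Functions on a strip with two imaginary periods\<close>

lemma imaginary_shift_iterate:
  fixes G :: "complex \<Rightarrow> complex"
  assumes "Re \<omega> = 0" and per: "\<And>t. \<bar>Re t\<bar> < l \<Longrightarrow> G (t + \<omega>) = G t"
    and "\<bar>Re t\<bar> < l"
  shows "G (t + of_int k * \<omega>) = G t"
proof -
  have step: "G (t + of_int (k + 1) * \<omega>) = G (t + of_int k * \<omega>)" for k
    using per[of "t + of_int k * \<omega>"] assms by (simp add: algebra_simps)
  show ?thesis
  proof (induction k rule: int_induct[where k = 0])
    case (step1 i)
    then show ?case using step[of i] by simp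
  next
    case (step2 i)
    then show ?case using step[of "i - 1"] by simp
  qed simp
qed

lemma open_convex_strip: "open {t. \<bar>Re t\<bar> < l}" "convex {t. \<bar>Re t\<bar> < l}"
proof -
  have S: "{t. \<bar>Re t\<bar> < l} = {t. Re t < l} \<inter> {t. Re t > - l}" by auto
  show "open {t. \<bar>Re t\<bar> < l}" "convex {t. \<bar>Re t\<bar> < l}"
    unfolding S by (auto intro!: open_Int open_halfspace_Re_lt open_halfspace_Re_gt
        convex_Int convex_halfspace_Re_lt convex_halfspace_Re_gt)
qed

text \<open>
  By Dirichlet's approximation theorem and the irrationality of \<open>\<alpha>\<close>, the group generated by the two
  periods contains arbitrarily small nonzero elements. So \<open>G\<close> takes the value \<open>G 0\<close> at points
  accumulating at \<open>0\<close>, and the identity theorem applies.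
\<close>

lemma two_imaginary_periods_imp_constant:
  fixes G :: "complex \<Rightarrow> complex"
  assumes irr: "\<alpha> \<notin> \<rat>" and l: "l > 0"
    and hol: "G holomorphic_on {t. \<bar>Re t\<bar> < l}"
    and per1: "\<And>t. \<bar>Re t\<bar> < l \<Longrightarrow> G (t + 2 * of_real pi * \<i>) = G t"
    and per2: "\<And>t. \<bar>Re t\<bar> < l \<Longrightarrow> G (t + 2 * of_real pi * of_real \<alpha> * \<i>) = G t"
    and t: "\<bar>Re t\<bar> < l"
  shows "G t = G 0"
proof -
  let ?S = "{t. \<bar>Re t\<bar> < l}"
  define shift where "shift h k = 2 * of_real pi * of_real (of_int k * \<alpha> - of_int h) * \<i>"
    for h k :: int
  have G_shift: "G (shift h k) = G 0" for h k
  proof -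
    have eq: "shift h k = (0 + of_int (- h) * (2 * of_real pi * \<i>)) + of_int k * (2 * of_real pi * of_real \<alpha> * \<i>)"
      by (simp add: shift_def algebra_simps)
    have "G (shift h k) = G (0 + of_int (- h) * (2 * of_real pi * \<i>))"
      unfolding eq by (rule imaginary_shift_iterate[where l = l]) (use per2 l in auto)
    also have "\<dots> = G 0"
      by (rule imaginary_shift_iterate[where l = l]) (use per1 l in auto)
    finally show ?thesis .
  qed
  let ?U = "{t \<in> ?S. G t - G 0 = 0}"
  have lim: "0 islimpt ?U"
    unfolding islimpt_approachable
  proof (intro allI impI)
    fix e :: real
    assume "e > 0"
    obtain N :: nat where N2: "2 * pi / e < N" using reals_Archimedean2 by blast
    moreover have "2 * pi / e > 0" using \<open>e > 0\<close> by simp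
    ultimately have "real N > 0" by linarith
    with N2 have N: "N > 0" "2 * pi / e < N" by simp_all
    obtain h k where hk: "0 < k" "\<bar>of_int k * \<alpha> - of_int h\<bar> < 1 / N"
      using Dirichlet_approx[OF N(1)] by metis
    have "of_int k * \<alpha> - of_int h \<noteq> 0"
    proof
      assume "of_int k * \<alpha> - of_int h = 0"
      then have "\<alpha> = of_int h / of_int k" using hk(1) by (simp add: field_simps)
      then show False using irr by simp
    qed
    then have "shift h k \<noteq> 0" by (auto simp: shift_def simp del: of_real_diff)
    moreover have "shift h k \<in> ?U" using G_shift l by (simp add: shift_def)
    moreover have "dist (shift h k) 0 < e"
    proof -
      have "norm (shift h k) = 2 * pi * \<bar>of_int k * \<alpha> - of_int h\<bar>"
        by (simp add: shift_def norm_mult del: of_real_diff)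
      also have "\<dots> < 2 * pi * (1 / N)" using hk(2) by (intro mult_strict_left_mono) auto
      also have "\<dots> < e" using N \<open>e > 0\<close> by (simp add: field_simps)
      finally show ?thesis by simp
    qed
    ultimately show "\<exists>x'\<in>?U. x' \<noteq> 0 \<and> dist x' 0 < e" by blast
  qed
  have "G t - G 0 = 0"
  proof (rule analytic_continuation[where f = "\<lambda>t. G t - G 0", OF _ open_convex_strip(1) _ _ _ lim])
    show "(\<lambda>t. G t - G 0) holomorphic_on ?S" using hol by (intro holomorphic_intros)
    show "connected ?S" using open_convex_strip(2) by (rule convex_connected)
  qed (use l t in auto)
  then show ?thesis by simp
qed

lemma log_deriv_of_multiplicative_period:
  fixes G :: "complex \<Rightarrow> complex"
  assumes hol: "G holomorphic_on {t. \<bar>Re t\<bar> < l}" and "Re \<omega> = 0" and "\<kappa> \<noteq> 0"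
    and per: "\<And>t. \<bar>Re t\<bar> < l \<Longrightarrow> G (t + \<omega>) = \<kappa> * G t"
    and t: "\<bar>Re t\<bar> < l"
  shows "deriv G (t + \<omega>) / G (t + \<omega>) = deriv G t / G t"
proof -
  note S = open_convex_strip(1)[of l]
  have "(G has_field_derivative deriv G (t + \<omega>)) (at (t + \<omega>))"
    by (rule holomorphic_derivI[OF hol S]) (use assms in auto)
  then have "((\<lambda>t. G (t + \<omega>)) has_field_derivative deriv G (t + \<omega>)) (at t)"
    by (simp add: DERIV_shift)
  then have "((\<lambda>t. \<kappa> * G t) has_field_derivative deriv G (t + \<omega>)) (at t)"
    by (rule has_field_derivative_transform_within_open[OF _ S]) (use per t in auto)
  moreover have "((\<lambda>t. \<kappa> * G t) has_field_derivative \<kappa> * deriv G t) (at t)"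
    by (intro DERIV_cmult holomorphic_derivI[OF hol S]) (use t in auto)
  ultimately have "deriv G (t + \<omega>) = \<kappa> * deriv G t" by (rule DERIV_unique)
  then show ?thesis using per[OF t] \<open>\<kappa> \<noteq> 0\<close> by simp
qed

lemma exp_eq_1_imp_int:
  assumes "exp (q * (2 * of_real pi * \<i>)) = 1"
  obtains m :: int where "q = of_int m"
proof -
  obtain m :: int where m: "Re (q * (2 * of_real pi * \<i>)) = 0" "Im (q * (2 * of_real pi * \<i>)) = of_int (2 * m) * pi"
    using assms exp_eq_1 by blast
  then have "q = of_int m" by (simp add: complex_eq_iff)
  then show ?thesis using that by blast
qed

text \<open>
  The quotient \<open>F t w / F t 0 = exp (p w)\<close> has both imaginary periods in \<open>t\<close>: the shift of \<open>w\<close> in the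
  second deck transformation cancels because an exponential is multiplicative. Hence \<open>p\<close> is the same
  on all leaves. Then \<open>F t 0\<close> has multiplicative periods, so its logarithmic derivative is constant
  too, and \<open>F\<close> is the exponential of a linear form in \<open>(t, w)\<close>. Invariance under the two deck
  transformations makes the coefficients integral.
\<close>

lemma exponential_on_leaves_imp_monomial:
  fixes F :: "complex \<Rightarrow> complex \<Rightarrow> complex"
  assumes irr: "\<alpha> \<notin> \<rat>" and l: "l > 0"
    and hol: "\<And>w. (\<lambda>t. F t w) holomorphic_on {t. \<bar>Re t\<bar> < l}"
    and nz: "\<And>t w. \<bar>Re t\<bar> < l \<Longrightarrow> F t w \<noteq> 0"
    and per1: "\<And>t w. \<bar>Re t\<bar> < l \<Longrightarrow> F (t + 2 * of_real pi * \<i>) w = F t w"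
    and per2: "\<And>t w. \<bar>Re t\<bar> < l \<Longrightarrow>
      F (t + 2 * of_real pi * of_real \<alpha> * \<i>) (w + 2 * of_real pi * \<i>) = F t w"
    and leaf: "\<And>t. \<bar>Re t\<bar> < l \<Longrightarrow> \<exists>p. \<forall>w. F t w = F t 0 * exp (p * w)"
  obtains b :: complex and m n :: int where "b \<noteq> 0"
    and "\<And>t w. \<bar>Re t\<bar> < l \<Longrightarrow>
      F t w = b * exp (of_int m * t + (of_int n - of_int m * of_real \<alpha>) * w)"
proof -
  let ?\<omega> = "2 * of_real pi * of_real \<alpha> * \<i> :: complex" and ?\<tau> = "2 * of_real pi * \<i> :: complex"
  obtain p where p: "\<And>w. F 0 w = F 0 0 * exp (p * w)" using leaf[of 0] l by auto
  have ratio: "F t w / F t 0 = F 0 w / F 0 0" if t: "\<bar>Re t\<bar> < l" for t w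
  proof (rule two_imaginary_periods_imp_constant[OF irr l _ _ _ t])
    show "(\<lambda>t. F t w / F t 0) holomorphic_on {t. \<bar>Re t\<bar> < l}"
      using hol nz by (intro holomorphic_intros) auto
    show "F (t + ?\<tau>) w / F (t + ?\<tau>) 0 = F t w / F t 0" if "\<bar>Re t\<bar> < l" for t
      using per1 that by simp
    show "F (t + ?\<omega>) w / F (t + ?\<omega>) 0 = F t w / F t 0" if t: "\<bar>Re t\<bar> < l" for t
    proof -
      have t': "\<bar>Re (t + ?\<omega>)\<bar> < l" using t by simp
      obtain p' where p': "\<And>w. F (t + ?\<omega>) w = F (t + ?\<omega>) 0 * exp (p' * w)"
        using leaf[OF t'] by auto
      have "F (t + ?\<omega>) w / F (t + ?\<omega>) 0 = exp (p' * w)"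
        using p'[of w] nz[OF t'] by simp
      also have "\<dots> = F (t + ?\<omega>) (w + ?\<tau>) / F (t + ?\<omega>) (0 + ?\<tau>)"
        using p'[of "w + ?\<tau>"] p'[of "0 + ?\<tau>"] nz[OF t', of 0] by (simp add: distrib_left exp_add)
      also have "\<dots> = F t w / F t 0" using per2[OF t] by metis
      finally show ?thesis .
    qed
  qed
  have F: "F t w = F t 0 * exp (p * w)" if "\<bar>Re t\<bar> < l" for t w
    using ratio[OF that, of w] p[of w] nz[OF that, of 0] nz[of 0 0] l by (simp add: field_simps)
  define G where "G t = F t 0" for t
  have holG: "G holomorphic_on {t. \<bar>Re t\<bar> < l}" using hol[of 0] unfolding G_def .
  have nzG: "G t \<noteq> 0" if "\<bar>Re t\<bar> < l" for t using nz that by (simp add: G_def)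
  have G1: "G (t + ?\<tau>) = 1 * G t" if "\<bar>Re t\<bar> < l" for t
    using per1[OF that] by (simp add: G_def)
  have G2: "G (t + ?\<omega>) = exp (- (p * ?\<tau>)) * G t" if "\<bar>Re t\<bar> < l" for t
    using per2[OF that, of 0] F[of "t + ?\<omega>" "0 + ?\<tau>"] that
    by (simp add: G_def exp_minus field_simps)
  have q: "deriv G t / G t = deriv G 0 / G 0" if t: "\<bar>Re t\<bar> < l" for t
  proof (rule two_imaginary_periods_imp_constant[OF irr l _ _ _ t])
    show "(\<lambda>t. deriv G t / G t) holomorphic_on {t. \<bar>Re t\<bar> < l}"
      using nzG holG open_convex_strip by (intro holomorphic_intros holomorphic_deriv) auto
    show "deriv G (t + ?\<tau>) / G (t + ?\<tau>) = deriv G t / G t" if "\<bar>Re t\<bar> < l" for t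
      by (rule log_deriv_of_multiplicative_period[OF holG _ _ G1 that]) auto
    show "deriv G (t + ?\<omega>) / G (t + ?\<omega>) = deriv G t / G t" if "\<bar>Re t\<bar> < l" for t
      by (rule log_deriv_of_multiplicative_period[OF holG _ _ G2 that]) auto
  qed
  define q where "q = deriv G 0 / G 0"
  have dG: "(G has_field_derivative q * G t) (at t)" if "\<bar>Re t\<bar> < l" for t
    using holomorphic_derivI[OF holG open_convex_strip(1), of t] q[OF that] nzG[OF that] that
    by (simp add: q_def field_simps)
  have "\<exists>c. \<forall>t\<in>{t. \<bar>Re t\<bar> < l}. G t * exp (- (q * t)) = c"
  proof (rule has_field_derivative_zero_constant)
    fix t assume t: "t \<in> {t. \<bar>Re t\<bar> < l}"
    have "((\<lambda>t. G t * exp (- (q * t))) has_field_derivative 0) (at t)"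
      using t by (auto intro!: derivative_eq_intros dG simp: algebra_simps)
    then show "((\<lambda>t. G t * exp (- (q * t))) has_field_derivative 0) (at t within {t. \<bar>Re t\<bar> < l})"
      by (rule has_field_derivative_at_within)
  qed (rule open_convex_strip)
  then obtain c where c: "\<And>t. \<bar>Re t\<bar> < l \<Longrightarrow> G t * exp (- (q * t)) = c" by blast
  have "c = G 0" using c[of 0] l by simp
  then have G: "G t = G 0 * exp (q * t)" if "\<bar>Re t\<bar> < l" for t
    using c[OF that] by (simp add: exp_minus field_simps)
  have "exp (q * ?\<tau>) = 1" using G1[of 0] G[of ?\<tau>] nzG[of 0] l by simp
  then obtain m :: int where m: "q = of_int m" using exp_eq_1_imp_int by blast
  have "exp (q * ?\<omega>) = exp (- (p * ?\<tau>))" using G2[of 0] G[of ?\<omega>] nzG[of 0] l by simp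
  then have "exp ((q * of_real \<alpha> + p) * ?\<tau>) = 1"
    by (simp add: distrib_right exp_add exp_minus field_simps)
  then obtain n :: int where n: "q * of_real \<alpha> + p = of_int n" using exp_eq_1_imp_int by blast
  have pn: "p = of_int n - of_int m * of_real \<alpha>" using n m by (simp add: algebra_simps)
  show ?thesis
  proof (rule that)
    show "G 0 \<noteq> 0" using nzG[of 0] l by simp
    show "F t w = G 0 * exp (of_int m * t + (of_int n - of_int m * of_real \<alpha>) * w)"
      if "\<bar>Re t\<bar> < l" for t w
      using F[OF that, of w] G[OF that] by (simp add: G_def pn m exp_add)
  qed
qed

section \<open>Proper maps along the leaves\<close>

lemma holomorphic_map_on_imp_continuous_on:
  assumes "holomorphic_map_on f U"
  shows "continuous_on U f"
  using assms unfolding holomorphic_map_on_def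
  by (meson continuous_at_imp_continuous_on has_derivative_continuous)

lemma holomorphic_map_on_along_curve:
  assumes f: "holomorphic_map_on f U" and U: "\<And>s. s \<in> S \<Longrightarrow> (g s, h s) \<in> U"
    and gh: "g holomorphic_on S" "h holomorphic_on S" and S: "open S"
  shows "(\<lambda>s. fst (f (g s, h s))) holomorphic_on S" "(\<lambda>s. snd (f (g s, h s))) holomorphic_on S"
proof -
  have "\<exists>v. ((\<lambda>s. fst (f (g s, h s))) has_field_derivative fst v) (at s) \<and>
            ((\<lambda>s. snd (f (g s, h s))) has_field_derivative snd v) (at s)" if s: "s \<in> S" for s
  proof -
    obtain f' where f': "(f has_derivative f') (at (g s, h s))"
      and lin: "\<And>c v. f' (cscale c v) = cscale c (f' v)"
      using f U[OF s] unfolding holomorphic_map_on_def by blast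
    let ?d = "(deriv g s, deriv h s)"
    have "((\<lambda>s. (g s, h s)) has_derivative (\<lambda>x. (deriv g s * x, deriv h s * x))) (at s)"
      using holomorphic_derivI[OF gh(1) S s] holomorphic_derivI[OF gh(2) S s]
      by (intro has_derivative_Pair) (simp_all add: has_field_derivative_def)
    from has_derivative_compose[OF this f']
    have D: "((\<lambda>s. f (g s, h s)) has_derivative (\<lambda>x. cscale x (f' ?d))) (at s)"
      using lin[of _ ?d] by (simp add: cscale_def mult.commute)
    show ?thesis
      using has_derivative_fst[OF D] has_derivative_snd[OF D]
      by (intro exI[of _ "f' ?d"]) (simp add: has_field_derivative_def cscale_def mult_commute_abs)
  qed
  then show "(\<lambda>s. fst (f (g s, h s))) holomorphic_on S" "(\<lambda>s. snd (f (g s, h s))) holomorphic_on S"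
    unfolding holomorphic_on_open[OF S] by blast+
qed

text \<open>
  For fixed \<open>t\<close> this runs through a leaf of the foliation of \<open>(\<complex> - {0})\<^sup>2\<close> defined by the form
  \<open>dz\<^sub>1 / z\<^sub>1 + \<alpha> dz\<^sub>2 / z\<^sub>2\<close>; the real part of \<open>t\<close> is the value of \<open>ln \<bar>z\<^sub>1\<bar> + \<alpha> ln \<bar>z\<^sub>2\<bar>\<close> on the leaf.
\<close>

definition leaf_param :: "real \<Rightarrow> complex \<Rightarrow> complex \<Rightarrow> complex \<times> complex" where
  "leaf_param \<alpha> t w = (exp (t - of_real \<alpha> * w), exp w)"

lemma leaf_param_in_D_iff:
  assumes "r > 1"
  shows "leaf_param \<alpha> t w \<in> D \<alpha> r \<longleftrightarrow> \<bar>Re t\<bar> < ln r"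
  unfolding leaf_param_def by (simp add: mem_D_iff[OF assms])

lemma leaf_param_surj:
  assumes "r > 1" "(z1, z2) \<in> D \<alpha> r"
  shows "(z1, z2) = leaf_param \<alpha> (Ln z1 + of_real \<alpha> * Ln z2) (Ln z2)"
  using assms by (simp add: mem_D_iff leaf_param_def)

text \<open>
  Liouville's theorem ties the logarithms \<open>g1\<close>, \<open>g2\<close> of the two components together: \<open>g1 + \<beta> g2\<close> is
  constant on the leaf. It remains to see that \<open>g2\<close> is affine, and for this the two hypotheses of
  the growth lemma come from two compact sets: \<open>K\<close> in the target, whose preimage is compact by
  properness, and \<open>Q\<close> in the source, on which \<open>f\<close> is bounded by continuity.
\<close>

lemma proper_map_exponential_on_leaves:
  assumes r: "r > 1" and R: "R > 1"
    and proper: "proper_holomorphic_map (D \<alpha> r) (D \<beta> R) f"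
    and t: "\<bar>Re t\<bar> < ln r"
  shows "\<exists>p. \<forall>w. fst (f (leaf_param \<alpha> t w)) = fst (f (leaf_param \<alpha> t 0)) * exp (p * w)"
    and "\<exists>p. \<forall>w. snd (f (leaf_param \<alpha> t w)) = snd (f (leaf_param \<alpha> t 0)) * exp (p * w)"
proof -
  have hol: "holomorphic_map_on f (D \<alpha> r)" and im: "\<And>z. z \<in> D \<alpha> r \<Longrightarrow> f z \<in> D \<beta> R"
    and cpt: "\<And>K. K \<subseteq> D \<beta> R \<Longrightarrow> compact K \<Longrightarrow> compact {z \<in> D \<alpha> r. f z \<in> K}"
    using proper unfolding proper_holomorphic_map_def by auto
  define F1 where "F1 w = fst (f (leaf_param \<alpha> t w))" for w
  define F2 where "F2 w = snd (f (leaf_param \<alpha> t w))" for w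
  have inD: "leaf_param \<alpha> t w \<in> D \<alpha> r" for w using leaf_param_in_D_iff[OF r] t by simp
  have "(F1 w, F2 w) \<in> D \<beta> R" for w using im[OF inD] by (simp add: F1_def F2_def)
  then have F: "F1 w \<noteq> 0" "F2 w \<noteq> 0" "\<bar>ln (norm (F1 w)) + \<beta> * ln (norm (F2 w))\<bar> < ln R" for w
    using mem_D_iff[OF R] by blast+
  have "F1 holomorphic_on UNIV" "F2 holomorphic_on UNIV"
    unfolding F1_def F2_def leaf_param_def using inD[unfolded leaf_param_def]
    by (auto intro!: holomorphic_map_on_along_curve[OF hol] holomorphic_intros)
  then obtain g1 g2 where g: "g1 holomorphic_on UNIV" "g2 holomorphic_on UNIV"
    and eg: "\<And>w. exp (g1 w) = F1 w" "\<And>w. exp (g2 w) = F2 w"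
    using holomorphic_logarithm_exists[of UNIV F1 0] holomorphic_logarithm_exists[of UNIV F2 0] F
    by (metis UNIV_I convex_UNIV open_UNIV)
  have Reg: "Re (g1 w) = ln (norm (F1 w))" "Re (g2 w) = ln (norm (F2 w))" for w
    by (simp_all flip: eg)
  have const: "g1 w + of_real \<beta> * g2 w = g1 0 + of_real \<beta> * g2 0" for w
  proof (rule entire_bounded_Re_imp_constant[where h = "\<lambda>w. g1 w + of_real \<beta> * g2 w"])
    show "(\<lambda>w. g1 w + of_real \<beta> * g2 w) holomorphic_on UNIV"
      using g by (intro holomorphic_intros)
    show "Re (g1 w + of_real \<beta> * g2 w) \<le> ln R" for w
      using F(3)[of w] by (simp add: Reg)
  qed
  define c where "c = Re (g1 0 + of_real \<beta> * g2 0)"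
  have c: "ln (norm (F1 w)) + \<beta> * ln (norm (F2 w)) = c" for w
    using arg_cong[OF const[of w], of Re] by (simp add: Reg c_def)
  have c_less: "\<bar>c\<bar> < ln R" using F(3)[of 0] c[of 0] by simp

  \<comment> \<open>The size of the box is such that a point of the level \<open>c\<close> with \<open>\<bar>ln \<bar>w\<^sub>2\<bar>\<bar> \<le> 1\<close> lies in it.\<close>
  define K where "K = {w \<in> torus_box (\<bar>c\<bar> + \<bar>\<beta>\<bar> + 1). ln (norm (fst w)) + \<beta> * ln (norm (snd w)) = c}"
  have "compact K" unfolding K_def by (rule compact_torus_box_level)
  moreover have "K \<subseteq> D \<beta> R"
    using c_less by (auto simp: K_def torus_box_def mem_D_iff[OF R])
  ultimately have "compact {z \<in> D \<alpha> r. f z \<in> K}" using cpt by blast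
  moreover have "continuous_on {z \<in> D \<alpha> r. f z \<in> K} (\<lambda>z. ln (norm (snd z)))"
    by (intro continuous_intros) (auto simp: mem_D_iff[OF r])
  ultimately have "bounded ((\<lambda>z. ln (norm (snd z))) ` {z \<in> D \<alpha> r. f z \<in> K})"
    by (intro compact_imp_bounded compact_continuous_image)
  then obtain N0 where N0: "\<And>z. z \<in> D \<alpha> r \<Longrightarrow> f z \<in> K \<Longrightarrow> \<bar>ln (norm (snd z))\<bar> \<le> N0"
    unfolding bounded_iff by (metis (mono_tags, lifting) imageI mem_Collect_eq real_norm_def)
  define N where "N = max N0 0"
  have far: "\<bar>Re (g2 w)\<bar> \<ge> 1" if w: "\<bar>Re w\<bar> > N" for w
  proof (rule ccontr)
    assume "\<not> \<bar>Re (g2 w)\<bar> \<ge> 1"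
    then have le: "\<bar>ln (norm (F2 w))\<bar> \<le> 1" by (simp add: Reg)
    have "\<bar>\<beta> * ln (norm (F2 w))\<bar> \<le> \<bar>\<beta>\<bar> * 1"
      unfolding abs_mult using le by (intro mult_left_mono) auto
    then have "\<bar>ln (norm (F1 w))\<bar> \<le> \<bar>c\<bar> + \<bar>\<beta>\<bar>" using c[of w] by linarith
    then have "(F1 w, F2 w) \<in> K"
      using le c[of w] F[of w] by (simp add: K_def torus_box_def)
    then have "f (leaf_param \<alpha> t w) \<in> K" by (simp add: F1_def F2_def)
    from N0[OF inD this] w show False by (simp add: leaf_param_def N_def)
  qed

  \<comment> \<open>\<open>Q\<close> contains all points of the leaf whose parameter satisfies \<open>\<bar>Re w\<bar> \<le> N + 2\<close>.\<close>
  define M where "M = (N + 2) * (1 + \<bar>\<alpha>\<bar>) + \<bar>Re t\<bar>"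
  have M: "M = (N + 2) + \<bar>\<alpha>\<bar> * (N + 2) + \<bar>Re t\<bar>" by (simp add: M_def algebra_simps)
  have "N \<ge> 0" by (simp add: N_def)
  define Q where "Q = {z \<in> torus_box M. ln (norm (fst z)) + \<alpha> * ln (norm (snd z)) = Re t}"
  have Q: "Q \<subseteq> D \<alpha> r"
    using t by (auto simp: Q_def torus_box_def mem_D_iff[OF r])
  have "f z \<in> D \<beta> R" if "z \<in> Q" for z using im Q that by blast
  then have "snd (f z) \<noteq> 0" if "z \<in> Q" for z
    using that by (metis mem_D_iff[OF R] prod.collapse)
  then have "continuous_on Q (\<lambda>z. ln (norm (snd (f z))))"
    using continuous_on_subset[OF holomorphic_map_on_imp_continuous_on[OF hol] Q]
    by (intro continuous_intros) auto
  then have "bounded ((\<lambda>z. ln (norm (snd (f z)))) ` Q)"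
    unfolding Q_def
    by (intro compact_imp_bounded compact_continuous_image compact_torus_box_level)
  then obtain C where C: "\<And>z. z \<in> Q \<Longrightarrow> \<bar>ln (norm (snd (f z)))\<bar> \<le> C"
    unfolding bounded_iff by (metis imageI real_norm_def)
  have near: "\<bar>Re (g2 w)\<bar> \<le> C" if w: "\<bar>Re w\<bar> \<le> N + 2" for w
  proof -
    have "\<bar>\<alpha> * Re w\<bar> \<le> \<bar>\<alpha>\<bar> * (N + 2)"
      unfolding abs_mult using w by (intro mult_left_mono) auto
    then have "\<bar>Re t - \<alpha> * Re w\<bar> \<le> M" "\<bar>Re w\<bar> \<le> M"
      using w M \<open>N \<ge> 0\<close> mult_nonneg_nonneg[of "\<bar>\<alpha>\<bar>" "N + 2"] by linarith+
    then have "leaf_param \<alpha> t w \<in> Q" by (simp add: Q_def torus_box_def leaf_param_def)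
    from C[OF this] show ?thesis by (simp add: Reg F2_def)
  qed

  obtain p where p: "\<And>w. g2 w = g2 0 + p * w"
    using entire_affine_if_Re_large_off_strip[OF g(2) \<open>N \<ge> 0\<close> far near] by blast
  have p': "g1 w = g1 0 + (- of_real \<beta> * p) * w" for w
    using const[of w] p[of w] by (simp add: algebra_simps)
  have "F2 w = F2 0 * exp (p * w)" "F1 w = F1 0 * exp ((- of_real \<beta> * p) * w)" for w
    unfolding eg[symmetric] by (subst p p', rule exp_add)+
  then show "\<exists>p. \<forall>w. fst (f (leaf_param \<alpha> t w)) = fst (f (leaf_param \<alpha> t 0)) * exp (p * w)"
    and "\<exists>p. \<forall>w. snd (f (leaf_param \<alpha> t w)) = snd (f (leaf_param \<alpha> t 0)) * exp (p * w)"
    unfolding F1_def F2_def by blast+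
qed

section \<open>Proper maps are monomial\<close>

lemma proper_map_is_monomial:
  assumes irr: "\<alpha> \<notin> \<rat>" and r: "r > 1" and R: "R > 1"
    and proper: "proper_holomorphic_map (D \<alpha> r) (D \<beta> R) f"
  obtains a b :: complex and m1 n1 m2 n2 :: int where "a \<noteq> 0" "b \<noteq> 0"
    and "\<forall>z1 z2. (z1, z2) \<in> D \<alpha> r \<longrightarrow>
      f (z1, z2) = (a * z1 powi m1 * z2 powi n1, b * z1 powi m2 * z2 powi n2)"
proof -
  have hol: "holomorphic_map_on f (D \<alpha> r)" and im: "\<And>z. z \<in> D \<alpha> r \<Longrightarrow> f z \<in> D \<beta> R"
    using proper unfolding proper_holomorphic_map_def by auto
  define F1 where "F1 t w = fst (f (leaf_param \<alpha> t w))" for t w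
  define F2 where "F2 t w = snd (f (leaf_param \<alpha> t w))" for t w
  have inD: "leaf_param \<alpha> t w \<in> D \<alpha> r" if "\<bar>Re t\<bar> < ln r" for t w
    using leaf_param_in_D_iff[OF r] that by simp
  have "(F1 t w, F2 t w) \<in> D \<beta> R" if "\<bar>Re t\<bar> < ln r" for t w
    using im[OF inD[OF that]] by (simp add: F1_def F2_def)
  then have nz: "F1 t w \<noteq> 0" "F2 t w \<noteq> 0" if "\<bar>Re t\<bar> < ln r" for t w
    using that mem_D_iff[OF R] by blast+
  have holF: "(\<lambda>t. F1 t w) holomorphic_on {t. \<bar>Re t\<bar> < ln r}"
    "(\<lambda>t. F2 t w) holomorphic_on {t. \<bar>Re t\<bar> < ln r}" for w
    unfolding F1_def F2_def leaf_param_def using inD[unfolded leaf_param_def]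
    by (auto intro!: holomorphic_map_on_along_curve[OF hol] holomorphic_intros open_convex_strip)
  have exp_2pi: "exp (z + 2 * of_real pi * \<i>) = exp z" for z
    by (simp add: exp_add mult.commute mult.left_commute)
  have per1: "leaf_param \<alpha> (t + 2 * of_real pi * \<i>) w = leaf_param \<alpha> t w" for t w
    using exp_2pi[of "t - of_real \<alpha> * w"] by (simp add: leaf_param_def algebra_simps)
  have per2: "leaf_param \<alpha> (t + 2 * of_real pi * of_real \<alpha> * \<i>) (w + 2 * of_real pi * \<i>)
      = leaf_param \<alpha> t w" for t w
    unfolding leaf_param_def exp_2pi by (simp add: algebra_simps)
  have "ln r > 0" using r by simp
  obtain a m1 n1 where a: "a \<noteq> 0" "\<And>t w. \<bar>Re t\<bar> < ln r \<Longrightarrow>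
      F1 t w = a * exp (of_int m1 * t + (of_int n1 - of_int m1 * of_real \<alpha>) * w)"
  proof (rule exponential_on_leaves_imp_monomial[OF irr \<open>ln r > 0\<close> holF(1) nz(1)])
    show "\<exists>p. \<forall>w. F1 t w = F1 t 0 * exp (p * w)" if "\<bar>Re t\<bar> < ln r" for t
      unfolding F1_def using proper_map_exponential_on_leaves(1)[OF r R proper that] .
  qed (simp_all add: F1_def per1 per2)
  obtain b m2 n2 where b: "b \<noteq> 0" "\<And>t w. \<bar>Re t\<bar> < ln r \<Longrightarrow>
      F2 t w = b * exp (of_int m2 * t + (of_int n2 - of_int m2 * of_real \<alpha>) * w)"
  proof (rule exponential_on_leaves_imp_monomial[OF irr \<open>ln r > 0\<close> holF(2) nz(2)])
    show "\<exists>p. \<forall>w. F2 t w = F2 t 0 * exp (p * w)" if "\<bar>Re t\<bar> < ln r" for t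
      unfolding F2_def using proper_map_exponential_on_leaves(2)[OF r R proper that] .
  qed (simp_all add: F2_def per1 per2)
  have "f (z1, z2) = (a * z1 powi m1 * z2 powi n1, b * z1 powi m2 * z2 powi n2)"
    if z: "(z1, z2) \<in> D \<alpha> r" for z1 z2
  proof -
    let ?t = "Ln z1 + of_real \<alpha> * Ln z2" and ?w = "Ln z2"
    have eq: "(z1, z2) = leaf_param \<alpha> ?t ?w" using leaf_param_surj[OF r z] .
    then have t: "\<bar>Re ?t\<bar> < ln r" using z leaf_param_in_D_iff[OF r] by metis
    have "z1 \<noteq> 0" "z2 \<noteq> 0" using z by (auto simp: mem_D_iff[OF r])
    then have mono: "exp (of_int m * ?t + (of_int n - of_int m * of_real \<alpha>) * ?w) = z1 powi m * z2 powi n" for m n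
    proof -
      have "of_int m * ?t + (of_int n - of_int m * of_real \<alpha>) * ?w = of_int m * Ln z1 + of_int n * Ln z2"
        by (simp add: algebra_simps)
      then show ?thesis
        using exp_power_int[of "Ln z1" m] exp_power_int[of "Ln z2" n] \<open>z1 \<noteq> 0\<close> \<open>z2 \<noteq> 0\<close>
        by (simp add: exp_add)
    qed
    have "f (z1, z2) = (F1 ?t ?w, F2 ?t ?w)" unfolding F1_def F2_def eq[symmetric] by simp
    then show ?thesis using a(2)[OF t, of ?w] b(2)[OF t, of ?w] by (simp only: mono mult.assoc)
  qed
  then show ?thesis using a(1) b(1) that by blast
qed

lemma log_norm_monomial:
  assumes "a \<noteq> 0" "z1 \<noteq> 0" "z2 \<noteq> (0::complex)"
  shows "ln (norm (a * z1 powi m * z2 powi n)) =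
    ln (norm a) + of_int m * ln (norm z1) + of_int n * ln (norm z2)"
proof -
  have "ln (norm z powi k) = of_int k * ln (norm z)" if "z \<noteq> 0" for z :: complex and k
  proof -
    have "norm z powi k = exp (ln (norm z)) powi k" using that by simp
    also have "\<dots> = exp (of_int k * ln (norm z))" by (rule exp_power_int)
    finally show ?thesis by simp
  qed
  then show ?thesis using assms by (simp add: norm_mult norm_power_int ln_mult)
qed

text \<open>
  In logarithmic coordinates the level \<open>ln \<bar>w\<^sub>1\<bar> + \<beta> ln \<bar>w\<^sub>2\<bar>\<close> of the image point is the affine
  function \<open>d + c ln \<bar>z\<^sub>1\<bar> + e ln \<bar>z\<^sub>2\<bar>\<close>. Boundedness along the leaves gives \<open>e = c \<alpha>\<close>. At a boundary
  point of \<open>D \<alpha> r\<close> with both coordinates nonzero the monomial map is still continuous, and by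
  properness its value there lies outside \<open>D \<beta> R\<close>, hence on the boundary level \<open>\<plusminus> ln R\<close>.
\<close>

lemma proper_monomial_map_exponents:
  assumes r: "r > 1" and R: "R > 1"
    and proper: "proper_holomorphic_map (D \<alpha> r) (D \<beta> R) f"
    and ab: "a \<noteq> 0" "b \<noteq> 0"
    and f: "\<And>z1 z2. (z1, z2) \<in> D \<alpha> r \<Longrightarrow>
      f (z1, z2) = (a * z1 powi m1 * z2 powi n1, b * z1 powi m2 * z2 powi n2)"
  shows "norm a * norm b powr \<beta> = 1"
    and "of_int n1 + of_int n2 * \<beta> = \<alpha> * (of_int m1 + of_int m2 * \<beta>)"
    and "\<bar>of_int m1 + of_int m2 * \<beta>\<bar> = ln R / ln r"
proof -
  define d where "d = ln (norm a) + \<beta> * ln (norm b)"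
  define c where "c = of_int m1 + of_int m2 * \<beta>"
  define e where "e = of_int n1 + of_int n2 * \<beta>"
  have im: "\<And>z. z \<in> D \<alpha> r \<Longrightarrow> f z \<in> D \<beta> R"
    and cpt: "\<And>K. K \<subseteq> D \<beta> R \<Longrightarrow> compact K \<Longrightarrow> compact {z \<in> D \<alpha> r. f z \<in> K}"
    using proper unfolding proper_holomorphic_map_def by auto
  have level: "ln (norm (a * z1 powi m1 * z2 powi n1)) + \<beta> * ln (norm (b * z1 powi m2 * z2 powi n2))
      = d + c * ln (norm z1) + e * ln (norm z2)" if "z1 \<noteq> 0" "z2 \<noteq> 0" for z1 z2
    using ab that by (simp add: log_norm_monomial) (simp add: d_def c_def e_def algebra_simps)
  have bound: "\<bar>d + c * (x - \<alpha> * y) + e * y\<bar> < ln R" if x: "\<bar>x\<bar> < ln r" for x y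
  proof -
    have D: "leaf_param \<alpha> (of_real x) (of_real y) \<in> D \<alpha> r"
      using x by (simp add: leaf_param_in_D_iff[OF r])
    from im[OF this] f[OF D[unfolded leaf_param_def]] show ?thesis
      using level[of "exp (of_real x - of_real \<alpha> * of_real y)" "exp (of_real y)"]
      by (simp add: leaf_param_def mem_D_iff[OF R])
  qed
  have lr: "ln r > 0" and lR: "ln R > 0" using r R by simp_all
  have "e = c * \<alpha>"
  proof (rule ccontr)
    assume "e \<noteq> c * \<alpha>"
    \<comment> \<open>At this point of the leaf \<open>t = 0\<close> the affine function would attain the excluded value \<open>ln R\<close>.\<close>
    define y where "y = (ln R - d) / (e - c * \<alpha>)"
    have "(e - c * \<alpha>) * y = ln R - d" using \<open>e \<noteq> c * \<alpha>\<close> by (simp add: y_def)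
    then have "d + c * (0 - \<alpha> * y) + e * y = ln R" by (simp add: algebra_simps)
    then show False using bound[of 0 y] lr lR by simp
  qed
  then show ec: "of_int n1 + of_int n2 * \<beta> = \<alpha> * (of_int m1 + of_int m2 * \<beta>)"
    by (simp add: c_def e_def mult.commute)
  have inner: "\<bar>d + c * x\<bar> < ln R" if "\<bar>x\<bar> < ln r" for x using bound[OF that, of 0] by simp
  have at_end: "\<bar>d + c * s\<bar> = ln R" if s: "\<bar>s\<bar> = ln r" for s
  proof (rule antisym)
    define u where "u n = real n / real (Suc n)" for n
    have u: "u n \<in> {0..1}" "\<bar>s * u n\<bar> < ln r" for n
      using lr s by (auto simp: u_def abs_mult field_simps)
    have X: "(\<lambda>n. s * u n) \<longlonglongrightarrow> s * 1"
      unfolding u_def by (intro tendsto_intros LIMSEQ_n_over_Suc_n)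
    have "(\<lambda>n. \<bar>d + c * (s * u n)\<bar>) \<longlonglongrightarrow> \<bar>d + c * (s * 1)\<bar>"
      by (intro tendsto_intros X)
    then have "\<bar>d + c * (s * 1)\<bar> \<le> ln R"
      by (rule LIMSEQ_le_const2) (use inner[OF u(2)] less_imp_le in blast)
    then show "\<bar>d + c * s\<bar> \<le> ln R" by simp
    show "ln R \<le> \<bar>d + c * s\<bar>"
    proof (rule ccontr)
      assume "\<not> ln R \<le> \<bar>d + c * s\<bar>"
      \<comment> \<open>Otherwise the image of the closed segment from \<open>(1, 1)\<close> to \<open>(exp s, 1)\<close> is a compact subset of
        \<open>D \<beta> R\<close>, whose preimage misses the limit point \<open>(exp s, 1)\<close> of the half-open segment.\<close>
      then have "\<bar>d + c * (s * x)\<bar> < ln R" if "x \<in> {0..1}" for x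
        using inner[of "s * x"] that s lr by (cases "x = 1") (auto simp: abs_mult)
      moreover define h where "h x = (a * exp (of_real (s * x)) powi m1 * 1 powi n1,
        b * exp (of_real (s * x)) powi m2 * 1 powi n2 :: complex)" for x :: real
      ultimately have hD: "h ` {0..1} \<subseteq> D \<beta> R"
        using level[of "exp (of_real (s * _))" 1] ab by (auto simp: mem_D_iff[OF R])
      have "continuous_on {0..1} h"
        unfolding h_def by (intro continuous_intros) auto
      then have "compact (h ` {0..1})" by (intro compact_continuous_image) auto
      then have clo: "closed {z \<in> D \<alpha> r. f z \<in> h ` {0..1}}" using cpt[OF hD] compact_imp_closed by blast
      define Z where "Z n = (exp (of_real (s * u n)) :: complex, 1 :: complex)" for n
      have mem: "Z n \<in> {z \<in> D \<alpha> r. f z \<in> h ` {0..1}}" for n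
      proof -
        have "Z n \<in> D \<alpha> r" using u(2)[of n] by (simp add: Z_def mem_D_iff[OF r] del: of_real_mult)
        moreover from this have "f (Z n) = h (u n)"
          unfolding Z_def h_def by (rule f)
        ultimately show ?thesis using u(1)[of n] by blast
      qed
      have lim: "Z \<longlonglongrightarrow> (exp (of_real (s * 1)), 1)"
        unfolding Z_def by (intro tendsto_intros X)
      have "(exp (of_real (s * 1)), 1) \<in> {z \<in> D \<alpha> r. f z \<in> h ` {0..1}}"
        by (rule closed_sequentially[OF clo mem lim])
      then show False using s by (simp add: mem_D_iff[OF r])
    qed
  qed
  \<comment> \<open>Both ends cannot go to the same level, since then \<open>\<bar>d\<bar>\<close> would equal \<open>ln R\<close>.\<close>
  have "\<bar>d\<bar> < ln R" using inner[of 0] lr by simp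
  moreover have "\<bar>d + c * ln r\<bar> = ln R" "\<bar>d - c * ln r\<bar> = ln R"
    using at_end[of "ln r"] at_end[of "- ln r"] lr by simp_all
  ultimately have d: "d = 0" and "\<bar>c * ln r\<bar> = ln R" by linarith+
  then have "\<bar>c\<bar> * ln r = ln R" using lr by (simp add: abs_mult)
  then show "\<bar>of_int m1 + of_int m2 * \<beta>\<bar> = ln R / ln r"
    using lr unfolding c_def[symmetric] by (simp add: field_simps)
  have "norm a * norm b powr \<beta> = exp d"
    using ab by (simp add: d_def exp_add powr_def)
  then show "norm a * norm b powr \<beta> = 1" using d by simp
qed

section \<open>Monomial maps are proper\<close>

text \<open>
  The map multiplies the level \<open>ln \<bar>z\<^sub>1\<bar> + \<alpha> ln \<bar>z\<^sub>2\<bar>\<close> by \<open>\<plusminus> ln R / ln r\<close>, so among points with nonzero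
  coordinates \<open>D \<alpha> r\<close> is exactly the preimage of \<open>D \<beta> R\<close>. Preimages of compact sets are therefore
  closed in \<open>(\<complex> - {0})\<^sup>2\<close>, and they are bounded in logarithmic coordinates because the exponent matrix
  has nonzero determinant.
\<close>

lemma monomial_map_proper:
  assumes irr: "\<alpha> \<notin> \<rat>" and r: "r > 1" and R: "R > 1"
    and ab: "norm a * norm b powr \<beta> = 1"
    and n: "of_int n1 + of_int n2 * \<beta> = \<alpha> * (of_int m1 + of_int m2 * \<beta>)"
    and m: "\<bar>of_int m1 + of_int m2 * \<beta>\<bar> = ln R / ln r"
    and f: "\<And>z1 z2. (z1, z2) \<in> D \<alpha> r \<Longrightarrow>
      f (z1, z2) = (a * z1 powi m1 * z2 powi n1, b * z1 powi m2 * z2 powi n2)"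
  shows "proper_holomorphic_map (D \<alpha> r) (D \<beta> R) f"
proof -
  define c where "c = of_int m1 + of_int m2 * \<beta>"
  define g where "g z = (a * fst z powi m1 * snd z powi n1, b * fst z powi m2 * snd z powi n2)"
    for z :: "complex \<times> complex"
  have lr: "ln r > 0" and lR: "ln R > 0" using r R by simp_all
  have c: "\<bar>c\<bar> * ln r = ln R" "c \<noteq> 0" using m lr lR by (auto simp: c_def field_simps)
  have fg: "f z = g z" if "z \<in> D \<alpha> r" for z
    using f[of "fst z" "snd z"] that by (simp add: g_def)
  have nz: "a \<noteq> 0" "b \<noteq> 0" using ab by auto
  have "exp (ln (norm a) + \<beta> * ln (norm b)) = 1"
    using nz ab by (simp add: exp_add powr_def)
  then have d0: "ln (norm a) + \<beta> * ln (norm b) = 0" by simp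
  have g_nz: "fst (g z) \<noteq> 0" "snd (g z) \<noteq> 0" if "fst z \<noteq> 0" "snd z \<noteq> 0" for z
    using that nz by (simp_all add: g_def)
  have level: "ln (norm (fst (g z))) + \<beta> * ln (norm (snd (g z)))
      = c * (ln (norm (fst z)) + \<alpha> * ln (norm (snd z)))" if z: "fst z \<noteq> 0" "snd z \<noteq> 0" for z
  proof -
    have "ln (norm (fst (g z))) + \<beta> * ln (norm (snd (g z)))
      = (ln (norm a) + \<beta> * ln (norm b)) + c * ln (norm (fst z))
        + (of_int n1 + of_int n2 * \<beta>) * ln (norm (snd z))"
      using z nz by (simp add: g_def log_norm_monomial) (simp add: c_def algebra_simps)
    then show ?thesis unfolding d0 n c_def[symmetric] by (simp add: algebra_simps)
  qed
  have D_iff: "g z \<in> D \<beta> R \<longleftrightarrow> z \<in> D \<alpha> r" if z: "fst z \<noteq> 0" "snd z \<noteq> 0" for z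
  proof -
    have "g z \<in> D \<beta> R \<longleftrightarrow> \<bar>c\<bar> * \<bar>ln (norm (fst z)) + \<alpha> * ln (norm (snd z))\<bar> < \<bar>c\<bar> * ln r"
      using mem_D_iff[OF R, of "fst (g z)" "snd (g z)"] g_nz[OF z] level[OF z] c(1)
      by (simp add: abs_mult)
    also have "\<dots> \<longleftrightarrow> z \<in> D \<alpha> r"
      using mem_D_iff[OF r, of "fst z" "snd z"] z c(2) by simp
    finally show ?thesis .
  qed
  have D_nz: "fst z \<noteq> 0" "snd z \<noteq> 0" if "z \<in> D \<alpha> r" for z
    using that mem_D_iff[OF r, of "fst z" "snd z"] by auto

  have hol: "holomorphic_map_on f (D \<alpha> r)"
    unfolding holomorphic_map_on_def
  proof
    fix z assume z: "z \<in> D \<alpha> r"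
    have mono: "\<exists>u v. ((\<lambda>z. x * fst z powi k * snd z powi j) has_derivative (\<lambda>h. u * fst h + v * snd h)) (at z)"
      for x :: complex and k j :: int
    proof -
      have "((\<lambda>z. x * fst z powi k * snd z powi j) has_derivative
        (\<lambda>h. (x * (of_int k * fst z powi (k - 1)) * snd z powi j) * fst h
           + (x * fst z powi k * (of_int j * snd z powi (j - 1))) * snd h)) (at z)"
        using D_nz[OF z] by (auto intro!: derivative_eq_intros simp: algebra_simps)
      then show ?thesis by blast
    qed
    obtain u1 v1 u2 v2 where
      "((\<lambda>z. a * fst z powi m1 * snd z powi n1) has_derivative (\<lambda>h. u1 * fst h + v1 * snd h)) (at z)"
      "((\<lambda>z. b * fst z powi m2 * snd z powi n2) has_derivative (\<lambda>h. u2 * fst h + v2 * snd h)) (at z)"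
      using mono by meson
    then have "(g has_derivative (\<lambda>h. (u1 * fst h + v1 * snd h, u2 * fst h + v2 * snd h))) (at z)"
      unfolding g_def by (rule has_derivative_Pair)
    then have "(f has_derivative (\<lambda>h. (u1 * fst h + v1 * snd h, u2 * fst h + v2 * snd h))) (at z)"
      by (rule has_derivative_transform_within_open[OF _ open_D[OF r] z]) (simp add: fg)
    then show "\<exists>f'. (f has_derivative f') (at z) \<and> (\<forall>c v. f' (cscale c v) = cscale c (f' v))"
      by (rule_tac exI) (auto simp: cscale_def algebra_simps)
  qed

  \<comment> \<open>A vanishing determinant would make \<open>\<alpha>\<close> a quotient of two integers.\<close>
  have det: "m1 * n2 \<noteq> m2 * n1"
  proof
    assume det0: "m1 * n2 = m2 * n1"
    have \<alpha>c: "\<alpha> * c = of_int n1 + of_int n2 * \<beta>" using n by (simp add: c_def)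
    have "of_int m1 * (\<alpha> * c) = of_int m1 * of_int n1 + of_int (m1 * n2) * \<beta>"
      unfolding \<alpha>c by (simp add: algebra_simps)
    also have "\<dots> = of_int n1 * c" by (simp add: det0 c_def algebra_simps)
    finally have 1: "of_int m1 * \<alpha> = of_int n1" using c(2) by simp
    have "of_int m2 * (\<alpha> * c) = of_int (m2 * n1) + of_int m2 * of_int n2 * \<beta>"
      unfolding \<alpha>c by (simp add: algebra_simps)
    also have "\<dots> = of_int n2 * c" by (simp add: c_def algebra_simps flip: det0)
    finally have 2: "of_int m2 * \<alpha> = of_int n2" using c(2) by simp
    have "k = 0" if "of_int k * \<alpha> = of_int j" for k j :: int
    proof (rule ccontr)
      assume "k \<noteq> 0"
      then have "\<alpha> = of_int j / of_int k" using that by (simp add: field_simps)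
      then show False using irr by simp
    qed
    then have "m1 = 0" "m2 = 0" using 1 2 by blast+
    then show False using c(2) by (simp add: c_def)
  qed

  have "compact {z \<in> D \<alpha> r. f z \<in> K}" if K: "K \<subseteq> D \<beta> R" "compact K" for K
  proof -
    have K_nz: "fst w \<noteq> 0" "snd w \<noteq> 0" if "w \<in> K" for w
      using that K(1) mem_D_iff[OF R, of "fst w" "snd w"] by auto
    have "continuous_on K (\<lambda>w. ln (norm (fst w)))" "continuous_on K (\<lambda>w. ln (norm (snd w)))"
      using K_nz by (auto intro!: continuous_intros)
    then have "bounded ((\<lambda>w. ln (norm (fst w))) ` K)" "bounded ((\<lambda>w. ln (norm (snd w))) ` K)"
      using K(2) by (auto intro!: compact_imp_bounded compact_continuous_image)
    then obtain B1 B2 where B: "\<And>w. w \<in> K \<Longrightarrow> \<bar>ln (norm (fst w))\<bar> \<le> B1"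
        "\<And>w. w \<in> K \<Longrightarrow> \<bar>ln (norm (snd w))\<bar> \<le> B2"
      unfolding bounded_iff by (metis imageI real_norm_def)
    define A1 where "A1 = B1 + \<bar>ln (norm a)\<bar>"
    define A2 where "A2 = B2 + \<bar>ln (norm b)\<bar>"
    define M where "M = max (\<bar>real_of_int n2\<bar> * A1 + \<bar>real_of_int n1\<bar> * A2)
      (\<bar>real_of_int m1\<bar> * A2 + \<bar>real_of_int m2\<bar> * A1)"
    have box: "z \<in> torus_box M" if z: "fst z \<noteq> 0" "snd z \<noteq> 0" "g z \<in> K" for z
    proof -
      define x where "x = ln (norm (fst z))"
      define y where "y = ln (norm (snd z))"
      define p where "p = of_int m1 * x + of_int n1 * y"
      define q where "q = of_int m2 * x + of_int n2 * y"
      have "ln (norm (fst (g z))) = ln (norm a) + p" "ln (norm (snd (g z))) = ln (norm b) + q"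
        using z nz by (simp_all add: g_def log_norm_monomial p_def q_def x_def y_def)
      then have pq: "\<bar>p\<bar> \<le> A1" "\<bar>q\<bar> \<le> A2"
        using B[OF z(3)] by (auto simp: A1_def A2_def)
      have prod: "\<bar>of_int k * p\<bar> \<le> \<bar>real_of_int k\<bar> * A1" "\<bar>of_int k * q\<bar> \<le> \<bar>real_of_int k\<bar> * A2" for k
        using pq by (auto simp: abs_mult intro!: mult_left_mono)
      \<comment> \<open>The determinant is a nonzero integer, so dividing by it in Cramer's rule does not increase
        absolute values.\<close>
      have D1: "1 \<le> \<bar>real_of_int (m1 * n2 - m2 * n1)\<bar>"
        using det by linarith
      have cramer: "of_int (m1 * n2 - m2 * n1) * x = of_int n2 * p - of_int n1 * q"
        "of_int (m1 * n2 - m2 * n1) * y = of_int m1 * q - of_int m2 * p"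
        by (simp_all add: p_def q_def algebra_simps)
      have "\<bar>x\<bar> \<le> \<bar>of_int (m1 * n2 - m2 * n1) * x\<bar>" "\<bar>y\<bar> \<le> \<bar>of_int (m1 * n2 - m2 * n1) * y\<bar>"
        using mult_right_mono[OF D1, of "\<bar>x\<bar>"] mult_right_mono[OF D1, of "\<bar>y\<bar>"]
        by (simp_all only: abs_mult abs_ge_zero mult_1)
      moreover have "\<bar>of_int n2 * p - of_int n1 * q\<bar> \<le> M" "\<bar>of_int m1 * q - of_int m2 * p\<bar> \<le> M"
        unfolding M_def
        by (intro max.coboundedI1 max.coboundedI2 order_trans[OF abs_triangle_ineq4] add_mono prod)+
      ultimately have "\<bar>x\<bar> \<le> M" "\<bar>y\<bar> \<le> M"
        unfolding cramer by linarith+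
      then show ?thesis using z by (simp add: torus_box_def x_def y_def)
    qed
    have "{z \<in> D \<alpha> r. f z \<in> K} = torus_box M \<inter> g -` K"
    proof (intro set_eqI iffI)
      fix z assume "z \<in> {z \<in> D \<alpha> r. f z \<in> K}"
      then show "z \<in> torus_box M \<inter> g -` K" using box[of z] D_nz[of z] fg[of z] by simp
    next
      fix z assume z: "z \<in> torus_box M \<inter> g -` K"
      then have "fst z \<noteq> 0" "snd z \<noteq> 0" by (auto simp: torus_box_def)
      moreover from z have "g z \<in> D \<beta> R" using K(1) by auto
      ultimately have "z \<in> D \<alpha> r" using D_iff by blast
      then show "z \<in> {z \<in> D \<alpha> r. f z \<in> K}" using z fg by simp
    qed
    moreover have "continuous_on (torus_box M) g"
      unfolding g_def by (intro continuous_intros) (auto simp: torus_box_def)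
    then have "closed (torus_box M \<inter> g -` K)"
      using K(2) compact_torus_box by (intro continuous_closed_preimage compact_imp_closed)
    then have "compact (torus_box M \<inter> (torus_box M \<inter> g -` K))"
      using compact_torus_box by (intro compact_Int_closed)
    ultimately show ?thesis by simp
  qed
  moreover have "f ` D \<alpha> r \<subseteq> D \<beta> R" using D_iff D_nz fg by auto
  ultimately show ?thesis using hol unfolding proper_holomorphic_map_def by blast
qed

section \<open>Classification\<close>

lemma proper_map_monomial_with_exponents:
  assumes irr: "\<alpha> \<notin> \<rat>" and r: "r > 1" and R: "R > 1"
    and proper: "proper_holomorphic_map (D \<alpha> r) (D \<beta> R) f"
  obtains a b :: complex and m1 n1 m2 n2 :: int where "norm a * norm b powr \<beta> = 1"
    and "of_int n1 + of_int n2 * \<beta> = \<alpha> * (of_int m1 + of_int m2 * \<beta>)"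
    and "\<bar>of_int m1 + of_int m2 * \<beta>\<bar> = ln R / ln r"
    and "\<forall>z1 z2. (z1, z2) \<in> D \<alpha> r \<longrightarrow>
      f (z1, z2) = (a * z1 powi m1 * z2 powi n1, b * z1 powi m2 * z2 powi n2)"
proof -
  obtain a b m1 n1 m2 n2 where "a \<noteq> 0" "b \<noteq> 0"
    and f: "\<forall>z1 z2. (z1, z2) \<in> D \<alpha> r \<longrightarrow>
      f (z1, z2) = (a * z1 powi m1 * z2 powi n1, b * z1 powi m2 * z2 powi n2)"
    using proper_map_is_monomial[OF assms] by blast
  then have "norm a * norm b powr \<beta> = 1"
    "of_int n1 + of_int n2 * \<beta> = \<alpha> * (of_int m1 + of_int m2 * \<beta>)"
    "\<bar>of_int m1 + of_int m2 * \<beta>\<bar> = ln R / ln r"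
    using proper_monomial_map_exponents[OF r R proper, of a b m1 n1 m2 n2] by blast+
  then show ?thesis using f by (rule that)
qed

lemma irrational_int_combination_unique:
  fixes k l k' l' :: int
  assumes "\<beta> \<notin> \<rat>" "of_int k + of_int l * \<beta> = of_int k' + of_int l' * \<beta>"
  shows "k = k' \<and> l = l'"
proof -
  have "l = l'"
  proof (rule ccontr)
    assume "l \<noteq> l'"
    then have "\<beta> = of_int (k' - k) / of_int (l - l')"
      using assms(2) by (simp add: field_simps)
    then show False using assms(1) by (metis Rats_divide Rats_of_int)
  qed
  then show ?thesis using assms(2) by simp
qed

theorem theorem1:
  "(\<forall>(\<alpha>::real) (\<beta>::real) (r::real) (R::real).
      \<alpha> \<notin> \<rat> \<and> \<beta> \<noteq> 0 \<and> r > 1 \<and> R > 1 \<longrightarrow>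
      ((\<exists>f. proper_holomorphic_map (D \<alpha> r) (D \<beta> R) f) \<longleftrightarrow>
       ln R / ln r \<in> int_span \<beta> \<and> \<alpha> * (ln R / ln r) \<in> int_span \<beta>))
   \<and>
   (\<forall>(\<alpha>::real) (\<beta>::real) (r::real) (R::real) (k1::int) (k2::int) (l1::int) (l2::int).
      \<alpha> \<notin> \<rat> \<and> \<beta> \<notin> \<rat> \<and> r > 1 \<and> R > 1 \<and>
      ln R / ln r = of_int k1 + of_int l1 * \<beta> \<and>
      \<alpha> * (ln R / ln r) = of_int k2 + of_int l2 * \<beta> \<longrightarrow>
      (\<forall>f. proper_holomorphic_map (D \<alpha> r) (D \<beta> R) f \<longrightarrow>
         (\<exists>a b :: complex. norm a * norm b powr \<beta> = 1 \<and>
            ((\<forall>z1 z2. (z1, z2) \<in> D \<alpha> r \<longrightarrow>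
                f (z1, z2) = (a * z1 powi k1 * z2 powi k2, b * z1 powi l1 * z2 powi l2)) \<or>
             (\<forall>z1 z2. (z1, z2) \<in> D \<alpha> r \<longrightarrow>
                f (z1, z2) = (a * z1 powi (-k1) * z2 powi (-k2),
                              b * z1 powi (-l1) * z2 powi (-l2)))))) \<and>
      (\<forall>f. \<forall>a b :: complex. norm a * norm b powr \<beta> = 1 \<and>
            ((\<forall>z1 z2. (z1, z2) \<in> D \<alpha> r \<longrightarrow>
                f (z1, z2) = (a * z1 powi k1 * z2 powi k2, b * z1 powi l1 * z2 powi l2)) \<or>
             (\<forall>z1 z2. (z1, z2) \<in> D \<alpha> r \<longrightarrow>
                f (z1, z2) = (a * z1 powi (-k1) * z2 powi (-k2),
                              b * z1 powi (-l1) * z2 powi (-l2)))) \<longrightarrow>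
         proper_holomorphic_map (D \<alpha> r) (D \<beta> R) f))"
proof (intro conjI allI impI; elim conjE)
  fix \<alpha> \<beta> r R :: real
  assume irr: "\<alpha> \<notin> \<rat>" and r: "r > 1" and R: "R > 1"
  show "(\<exists>f. proper_holomorphic_map (D \<alpha> r) (D \<beta> R) f) \<longleftrightarrow>
       ln R / ln r \<in> int_span \<beta> \<and> \<alpha> * (ln R / ln r) \<in> int_span \<beta>"
  proof
    assume "\<exists>f. proper_holomorphic_map (D \<alpha> r) (D \<beta> R) f"
    then obtain f where proper: "proper_holomorphic_map (D \<alpha> r) (D \<beta> R) f" ..
    obtain a b m1 n1 m2 n2 where "norm a * norm b powr \<beta> = 1"
        and n: "of_int n1 + of_int n2 * \<beta> = \<alpha> * (of_int m1 + of_int m2 * \<beta>)"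
        and m: "\<bar>of_int m1 + of_int m2 * \<beta>\<bar> = ln R / ln r"
      and "\<forall>z1 z2. (z1, z2) \<in> D \<alpha> r \<longrightarrow>
          f (z1, z2) = (a * z1 powi m1 * z2 powi n1, b * z1 powi m2 * z2 powi n2)"
      by (rule proper_map_monomial_with_exponents[OF irr r R proper]) (rule that)
    from m consider "ln R / ln r = of_int m1 + of_int m2 * \<beta>"
      | "ln R / ln r = of_int (- m1) + of_int (- m2) * \<beta>" by fastforce
    then show "ln R / ln r \<in> int_span \<beta> \<and> \<alpha> * (ln R / ln r) \<in> int_span \<beta>"
    proof cases
      case 1
      then have "\<alpha> * (ln R / ln r) = of_int n1 + of_int n2 * \<beta>" using n by simp
      with 1 show ?thesis unfolding int_span_def by blast
    next
      case 2
      then have "\<alpha> * (ln R / ln r) = of_int (- n1) + of_int (- n2) * \<beta>"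
        unfolding 2 using n by (simp add: algebra_simps)
      with 2 show ?thesis unfolding int_span_def by blast
    qed
  next
    assume "ln R / ln r \<in> int_span \<beta> \<and> \<alpha> * (ln R / ln r) \<in> int_span \<beta>"
    then obtain m1 n1 m2 n2 :: int where m: "ln R / ln r = of_int m1 + of_int m2 * \<beta>"
      and n: "\<alpha> * (ln R / ln r) = of_int n1 + of_int n2 * \<beta>"
      unfolding int_span_def by blast
    have "\<bar>of_int m1 + of_int m2 * \<beta>\<bar> = ln R / ln r" using r R by (simp flip: m)
    moreover have "of_int n1 + of_int n2 * \<beta> = \<alpha> * (of_int m1 + of_int m2 * \<beta>)"
      using m n by simp
    ultimately have "proper_holomorphic_map (D \<alpha> r) (D \<beta> R)
        (\<lambda>(z1, z2). (1 * z1 powi m1 * z2 powi n1, 1 * z1 powi m2 * z2 powi n2))"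
      by (intro monomial_map_proper[OF irr r R]) auto
    then show "\<exists>f. proper_holomorphic_map (D \<alpha> r) (D \<beta> R) f" by blast
  qed
next
  fix \<alpha> \<beta> r R :: real and k1 k2 l1 l2 :: int and f
  assume irr: "\<alpha> \<notin> \<rat>" "\<beta> \<notin> \<rat>" and r: "r > 1" and R: "R > 1"
    and k: "ln R / ln r = of_int k1 + of_int l1 * \<beta>"
      "\<alpha> * (ln R / ln r) = of_int k2 + of_int l2 * \<beta>"
    and proper: "proper_holomorphic_map (D \<alpha> r) (D \<beta> R) f"
  obtain a b m1 n1 m2 n2 where ab: "norm a * norm b powr \<beta> = 1"
    and n: "of_int n1 + of_int n2 * \<beta> = \<alpha> * (of_int m1 + of_int m2 * \<beta>)"
    and m: "\<bar>of_int m1 + of_int m2 * \<beta>\<bar> = ln R / ln r"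
    and f: "\<forall>z1 z2. (z1, z2) \<in> D \<alpha> r \<longrightarrow>
      f (z1, z2) = (a * z1 powi m1 * z2 powi n1, b * z1 powi m2 * z2 powi n2)"
    by (rule proper_map_monomial_with_exponents[OF irr(1) r R proper]) (rule that)
  from m consider "of_int m1 + of_int m2 * \<beta> = ln R / ln r"
    | "of_int m1 + of_int m2 * \<beta> = - (ln R / ln r)" by fastforce
  then have "m1 = k1 \<and> m2 = l1 \<and> n1 = k2 \<and> n2 = l2 \<or>
    m1 = - k1 \<and> m2 = - l1 \<and> n1 = - k2 \<and> n2 = - l2"
  proof cases
    case 1
    then show ?thesis
      using n k irrational_int_combination_unique[OF irr(2), of m1 m2 k1 l1]
        irrational_int_combination_unique[OF irr(2), of n1 n2 k2 l2] by simp
  next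
    case 2
    then have "of_int m1 + of_int m2 * \<beta> = of_int (- k1) + of_int (- l1) * \<beta>"
      using k(1) by simp
    moreover have "of_int n1 + of_int n2 * \<beta> = - (\<alpha> * (ln R / ln r))"
      unfolding n 2 by simp
    then have "of_int n1 + of_int n2 * \<beta> = of_int (- k2) + of_int (- l2) * \<beta>"
      unfolding k(2) by simp
    ultimately show ?thesis
      using irrational_int_combination_unique[OF irr(2)] by blast
  qed
  then show "\<exists>a b :: complex. norm a * norm b powr \<beta> = 1 \<and>
            ((\<forall>z1 z2. (z1, z2) \<in> D \<alpha> r \<longrightarrow>
                f (z1, z2) = (a * z1 powi k1 * z2 powi k2, b * z1 powi l1 * z2 powi l2)) \<or>
             (\<forall>z1 z2. (z1, z2) \<in> D \<alpha> r \<longrightarrow>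
                f (z1, z2) = (a * z1 powi (-k1) * z2 powi (-k2),
                              b * z1 powi (-l1) * z2 powi (-l2))))"
    using ab f by blast
next
  fix \<alpha> \<beta> r R :: real and k1 k2 l1 l2 :: int and f and a b :: complex
  assume irr: "\<alpha> \<notin> \<rat>" and r: "r > 1" and R: "R > 1"
    and k: "ln R / ln r = of_int k1 + of_int l1 * \<beta>"
      "\<alpha> * (ln R / ln r) = of_int k2 + of_int l2 * \<beta>"
    and ab: "norm a * norm b powr \<beta> = 1"
    and f: "(\<forall>z1 z2. (z1, z2) \<in> D \<alpha> r \<longrightarrow>
                f (z1, z2) = (a * z1 powi k1 * z2 powi k2, b * z1 powi l1 * z2 powi l2)) \<or>
             (\<forall>z1 z2. (z1, z2) \<in> D \<alpha> r \<longrightarrow>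
                f (z1, z2) = (a * z1 powi (-k1) * z2 powi (-k2),
                              b * z1 powi (-l1) * z2 powi (-l2)))"
  have rel: "of_int k2 + of_int l2 * \<beta> = \<alpha> * (of_int k1 + of_int l1 * \<beta>)"
    using k by simp
  have abs: "\<bar>of_int k1 + of_int l1 * \<beta>\<bar> = ln R / ln r"
    using r R by (simp flip: k(1))
  from f show "proper_holomorphic_map (D \<alpha> r) (D \<beta> R) f"
  proof
    assume "\<forall>z1 z2. (z1, z2) \<in> D \<alpha> r \<longrightarrow>
      f (z1, z2) = (a * z1 powi k1 * z2 powi k2, b * z1 powi l1 * z2 powi l2)"
    then show ?thesis by (intro monomial_map_proper[OF irr r R ab rel abs]) auto
  next
    assume f: "\<forall>z1 z2. (z1, z2) \<in> D \<alpha> r \<longrightarrow>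
      f (z1, z2) = (a * z1 powi (-k1) * z2 powi (-k2), b * z1 powi (-l1) * z2 powi (-l2))"
    have "of_int (- k2) + of_int (- l2) * \<beta> = - (of_int k2 + of_int l2 * \<beta>)" by simp
    also have "\<dots> = \<alpha> * (of_int (- k1) + of_int (- l1) * \<beta>)"
      unfolding rel by (simp add: algebra_simps)
    finally have "of_int (- k2) + of_int (- l2) * \<beta> = \<alpha> * (of_int (- k1) + of_int (- l1) * \<beta>)" .
    moreover have "\<bar>of_int (- k1) + of_int (- l1) * \<beta>\<bar> = ln R / ln r"
      using abs by (simp add: abs_if split: if_splits)
    ultimately show ?thesis by (rule monomial_map_proper[OF irr r R ab]) (use f in auto)
  qed
qed

end
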